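(* Let $H$ be a complex Hilbert space with $\dim H\ge 3$, and let $\mathcal A$ and $\mathcal B$ be subsets of $\mathcal B(H)$ each of which contains $\mathcal F_1(H)$. Suppose $\Phi:\mathcal A\to\mathcal B$ is a surjective map such that $$A^*B=0\iff \Phi(A)^*\Phi(B)=0\qquad\text{for all }A,B\in\mathcal A.$$ Then $\Phi$ preserves rank one operators in both directions, and $\Phi(0)=0$ if $0\in\mathcal A$. Moreover, there exist a unitary operator $U\in\mathcal B(H)$ and a map $h:H\times H\to H$ such that either $$\Phi(x\otimes f)=Ux\otimes h(x,f)\quad\text{for all nonzero }x,f\in H,$$ or $$\Phi(x\otimes f)=UJx\otimes h(x,f)\quad\text{for all nonzero }x,f\in H.$$
   Context: $\mathcal B(H)$ is the algebra of all bounded linear operators on $H$, and $\mathcal F_1(H)$ is the set of all rank one operators in $\mathcal B(H)$. For $x,f\in H$, $x\otimes f$ denotes the operator $z\mapsto\langle z,f\rangle x$. An arbitrary orthogonal basis $\{e_i\}_{i\in\Gamma}$ of $H$ is fixed, and $J:H\to H$ is the conjugation $J\left(\sum_i\xi_ie_i\right)=\sum_i\overline{\xi_i}e_i$. "$\Phi$ preserves rank one operators in both directions" means that for $A\in\mathcal A$, $A$ has rank one if and only if $\Phi(A)$ has rank one. *)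

theory Defs
  imports "HOL-Analysis.Analysis"
begin

text \<open>
  Complex Hilbert spaces. The inner product is linear in its \<^emph>\<open>first\<close> argument, and the real
  structure inherited from \<^class>\<open>real_inner\<close> (scalar multiplication, inner product, hence norm and
  topology) is required to be the one underlying the complex structure.
\<close>

class chilbert_space = real_inner + complete_space +
  fixes scaleC :: "complex \<Rightarrow> 'a \<Rightarrow> 'a"  (infixr "*\<^sub>C" 75)
    and cinner :: "'a \<Rightarrow> 'a \<Rightarrow> complex"
  assumes scaleC_add_right: "c *\<^sub>C (x + y) = c *\<^sub>C x + c *\<^sub>C y"
    and scaleC_add_left: "(c + d) *\<^sub>C x = c *\<^sub>C x + d *\<^sub>C x"
    and scaleC_scaleC: "c *\<^sub>C d *\<^sub>C x = (c * d) *\<^sub>C x"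
    and scaleC_one: "1 *\<^sub>C x = x"
    and scaleR_eq_scaleC: "r *\<^sub>R x = complex_of_real r *\<^sub>C x"
    and cinner_commute: "cinner x y = cnj (cinner y x)"
    and cinner_add_left: "cinner (x + y) z = cinner x z + cinner y z"
    and cinner_scaleC_left: "cinner (c *\<^sub>C x) y = c * cinner x y"
    and inner_eq_Re_cinner: "inner x y = Re (cinner x y)"

global_interpretation complex_vector: vector_space "scaleC :: complex \<Rightarrow> 'a \<Rightarrow> 'a::chilbert_space"
  by unfold_locales (simp_all add: scaleC_add_right scaleC_add_left scaleC_scaleC scaleC_one)

definition bounded_ops :: "('a::chilbert_space \<Rightarrow> 'a) set" where
  "bounded_ops = {A. bounded_linear A \<and> (\<forall>c x. A (c *\<^sub>C x) = c *\<^sub>C A x)}"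

text \<open>As for \<^const>\<open>adjoint\<close>; existence and uniqueness for bounded operators is the Riesz theorem.\<close>

definition cadjoint :: "('a::chilbert_space \<Rightarrow> 'a) \<Rightarrow> 'a \<Rightarrow> 'a" where
  "cadjoint A = (SOME B. \<forall>x y. cinner (A x) y = cinner x (B y))"

definition unitary_op :: "('a::chilbert_space \<Rightarrow> 'a) \<Rightarrow> bool" where
  "unitary_op U \<longleftrightarrow> U \<in> bounded_ops \<and> cadjoint U \<circ> U = id \<and> U \<circ> cadjoint U = id"

definition rank_one_ops :: "('a::chilbert_space \<Rightarrow> 'a) set" where
  "rank_one_ops = {A \<in> bounded_ops. complex_vector.dim (range A) = 1}"

definition tensor_op :: "'a::chilbert_space \<Rightarrow> 'a \<Rightarrow> 'a \<Rightarrow> 'a"  (infix "\<otimes>\<^sub>o" 70) where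
  "x \<otimes>\<^sub>o f = (\<lambda>z. cinner z f *\<^sub>C x)"

definition orthogonal_basis :: "'i set \<Rightarrow> ('i \<Rightarrow> 'a::chilbert_space) \<Rightarrow> bool" where
  "orthogonal_basis \<Gamma> e \<longleftrightarrow>
     (\<forall>i\<in>\<Gamma>. e i \<noteq> 0) \<and>
     (\<forall>i\<in>\<Gamma>. \<forall>j\<in>\<Gamma>. i \<noteq> j \<longrightarrow> cinner (e i) (e j) = 0) \<and>
     closure (complex_vector.span (e ` \<Gamma>)) = UNIV"

text \<open>
  The conjugation with respect to an orthogonal basis, sending a sum of the \<open>\<xi> i *\<^sub>C e i\<close> to the sum
  of the \<open>cnj (\<xi> i) *\<^sub>C e i\<close> (see \<open>basis_conj_infsum\<close> below). The coefficients of a vector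
  are written as Fourier coefficients; the basis need not be normalised.
\<close>

definition basis_conj :: "'i set \<Rightarrow> ('i \<Rightarrow> 'a::chilbert_space) \<Rightarrow> 'a \<Rightarrow> 'a" where
  "basis_conj \<Gamma> e x = (\<Sum>\<^sub>\<infinity>i\<in>\<Gamma>. cnj (cinner x (e i) / cinner (e i) (e i)) *\<^sub>C e i)"

lemma cinner_scaleC_right: "cinner x (c *\<^sub>C y) = cnj c * cinner x y" for x :: "'a::chilbert_space"
  by (metis cinner_commute cinner_scaleC_left complex_cnj_mult)

lemma cinner_self: "cinner x x = complex_of_real (inner x x)" for x :: "'a::chilbert_space"
  using cinner_commute[of x x] by (auto simp: complex_eq_iff inner_eq_Re_cinner)

lemma bounded_linear_cinner_left: "bounded_linear (\<lambda>x. cinner x y)" for y :: "'a::chilbert_space"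
proof -
  have "linear (\<lambda>x. cinner x y)"
    by (rule linearI)
      (simp_all add: cinner_add_left scaleR_eq_scaleC cinner_scaleC_left scaleR_conv_of_real)
  moreover have "norm (cinner x y) \<le> norm x * (2 * norm y)" for x
  proof -
    have "cinner ((- \<i>) *\<^sub>C x) ((- \<i>) *\<^sub>C x) = cinner x x"
      by (simp only: cinner_scaleC_left cinner_scaleC_right) simp
    hence n: "norm ((- \<i>) *\<^sub>C x) = norm x"
      unfolding norm_eq_sqrt_inner inner_eq_Re_cinner by simp
    have "Im (cinner x y) = inner ((- \<i>) *\<^sub>C x) y"
      by (simp only: inner_eq_Re_cinner cinner_scaleC_left) simp
    hence "\<bar>Im (cinner x y)\<bar> \<le> norm x * norm y"
      using Cauchy_Schwarz_ineq2[of "(- \<i>) *\<^sub>C x" y] n by simp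
    moreover have "\<bar>Re (cinner x y)\<bar> \<le> norm x * norm y"
      using Cauchy_Schwarz_ineq2[of x y] by (simp add: inner_eq_Re_cinner)
    ultimately show ?thesis
      using cmod_le[of "cinner x y"] by simp
  qed
  ultimately show ?thesis
    unfolding bounded_linear_def bounded_linear_axioms_def by blast
qed

lemma basis_conj_infsum:
  fixes e :: "'i \<Rightarrow> 'a::chilbert_space"
  assumes "orthogonal_basis \<Gamma> e" and x: "((\<lambda>i. \<xi> i *\<^sub>C e i) has_sum x) \<Gamma>"
  shows "basis_conj \<Gamma> e x = (\<Sum>\<^sub>\<infinity>i\<in>\<Gamma>. cnj (\<xi> i) *\<^sub>C e i)"
proof -
  have "cinner x (e j) / cinner (e j) (e j) = \<xi> j" if j: "j \<in> \<Gamma>" for j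
  proof -
    have "((\<lambda>i. cinner (\<xi> i *\<^sub>C e i) (e j)) has_sum cinner x (e j)) \<Gamma>"
      using has_sum_bounded_linear[OF bounded_linear_cinner_left x] by (simp add: o_def)
    moreover have "((\<lambda>i. cinner (\<xi> i *\<^sub>C e i) (e j)) has_sum (\<xi> j * cinner (e j) (e j))) \<Gamma>"
      using assms(1) j
      by (intro has_sum_finite_neutralI[of "{j}"])
        (auto simp: orthogonal_basis_def cinner_scaleC_left)
    ultimately have "cinner x (e j) = \<xi> j * cinner (e j) (e j)"
      using has_sum_unique by blast
    moreover have "cinner (e j) (e j) \<noteq> 0"
      using assms(1) j by (simp add: cinner_self orthogonal_basis_def)
    ultimately show ?thesis by simp
  qed
  thus ?thesis
    unfolding basis_conj_def by (intro infsum_cong) simp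
qed

end

theory Submission
  imports Defs
begin

text \<open>
  By the defining property of the adjoint, \<open>A\<^sup>* B = 0\<close> says that the ranges of \<open>A\<close> and \<open>B\<close> are
  orthogonal, so \<open>\<Phi>\<close> is a map that respects orthogonality of ranges. Inclusion of closed ranges can be
  expressed by this relation alone, because \<open>\<A>\<close> and \<open>\<B>\<close> contain all the operators \<open>w \<otimes>\<^sub>o w\<close>, which test
  orthogonality against a single vector. The rank one operators are the minimal nonzero elements of
  this preorder (\<open>rank_one_iff_minimal\<close>), and therefore they correspond to each other under \<open>\<Phi>\<close>. Zero is
  the only operator whose range is orthogonal to itself.

  The operators \<open>x \<otimes>\<^sub>o f\<close> with a given \<open>x\<close> have the same range. Hence the range of \<open>\<Phi> (x \<otimes>\<^sub>o f)\<close> depends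
  only on the line of \<open>x\<close>, and \<open>\<Phi>\<close> induces a map of the lines of the Hilbert space that is onto and
  preserves orthogonality in both directions. In dimension at least three such a map comes from a
  unitary or antiunitary operator \<open>U\<close> (\<open>uhlhorn\<close>). To see this, the lines that are not orthogonal to
  a unit vector \<open>e1\<close> are written as the lines of \<open>e1 + v\<close> with \<open>v\<close> orthogonal to \<open>e1\<close>. The line map becomes
  a map \<open>T\<close> of vectors, and orthogonality becomes the condition \<open>\<langle>v, w\<rangle> = - 1\<close>, which fixes the scale of
  vectors. This makes \<open>T\<close> additive, and homogeneous up to an endomorphism \<open>\<sigma>\<close> of the field of complex
  numbers. It also gives \<open>\<langle>T v, T w\<rangle> = cnj (\<sigma> (cnj \<langle>v, w\<rangle>))\<close>, so \<open>\<sigma>\<close> sends squared norms to squared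
  norms. An endomorphism with this property is monotone on the reals, and so it is the identity or
  complex conjugation.

  If \<open>U\<close> is antiunitary, then \<open>U \<circ> J\<close> is unitary for the conjugation \<open>J\<close> of the given basis, and
  \<open>U = (U \<circ> J) \<circ> J\<close>, since \<open>J\<close> is an antiunitary involution (\<open>cinner_basis_conj\<close>,
  \<open>basis_conj_involution\<close>). This rests on the convergence of Fourier series with respect to an
  orthogonal basis, and of the series with conjugated coefficients.
\<close>

section \<open>Complex inner products\<close>

lemma cinner_add_right: "cinner x (y + z) = cinner x y + cinner x z" for x :: "'a::chilbert_space"
  by (metis cinner_add_left cinner_commute complex_cnj_add)

lemma cinner_zero_left [simp]: "cinner 0 x = 0" for x :: "'a::chilbert_space"
  using cinner_add_left[of 0 0 x] by simp

lemma cinner_zero_right [simp]: "cinner x 0 = 0" for x :: "'a::chilbert_space"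
  using cinner_add_right[of x 0 0] by simp

lemma cinner_minus_left [simp]: "cinner (- x) y = - cinner x y" for x :: "'a::chilbert_space"
  using cinner_add_left[of x "- x" y] by (simp add: add_eq_0_iff)

lemma cinner_minus_right [simp]: "cinner x (- y) = - cinner x y" for x :: "'a::chilbert_space"
  using cinner_add_right[of x y "- y"] by (simp add: add_eq_0_iff)

lemma cinner_diff_left: "cinner (x - y) z = cinner x z - cinner y z" for x :: "'a::chilbert_space"
  using cinner_add_left[of x "- y" z] by simp

lemma cinner_diff_right: "cinner x (y - z) = cinner x y - cinner x z" for x :: "'a::chilbert_space"
  using cinner_add_right[of x y "- z"] by simp

lemmas cinner_linear = cinner_add_left cinner_add_right cinner_diff_left cinner_diff_right
  cinner_scaleC_left cinner_scaleC_right

lemma cinner_self_norm: "cinner x x = complex_of_real ((norm x)\<^sup>2)" for x :: "'a::chilbert_space"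
  by (simp add: cinner_self power2_norm_eq_inner)

lemma cinner_self_eq_0 [simp]: "cinner x x = 0 \<longleftrightarrow> x = 0" for x :: "'a::chilbert_space"
  by (simp add: cinner_self)

lemma cinner_eq_0_commute: "cinner x y = 0 \<longleftrightarrow> cinner y x = 0" for x :: "'a::chilbert_space"
  by (metis cinner_commute complex_cnj_zero)

lemma norm_scaleC: "norm (c *\<^sub>C x) = cmod c * norm x" for x :: "'a::chilbert_space"
proof -
  have "cinner (c *\<^sub>C x) (c *\<^sub>C x) = complex_of_real ((cmod c)\<^sup>2) * cinner x x"
    unfolding complex_norm_square by (simp add: cinner_linear)
  hence "(norm (c *\<^sub>C x))\<^sup>2 = (cmod c * norm x)\<^sup>2"
    unfolding cinner_self_norm of_real_mult[symmetric] of_real_eq_iff by (simp add: power_mult_distrib)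
  thus ?thesis by (rule power2_eq_imp_eq) simp_all
qed

lemma cinner_self_cnj: "cnj (cinner x x) = cinner x x" for x :: "'a::chilbert_space"
  by (metis cinner_commute)

lemma cinner_sum_left: "cinner (\<Sum>i\<in>F. g i) y = (\<Sum>i\<in>F. cinner (g i) y)"
  for y :: "'a::chilbert_space"
  by (induction F rule: infinite_finite_induct) (simp_all add: cinner_add_left)

lemma bounded_linear_scaleC_right: "bounded_linear (\<lambda>x. c *\<^sub>C x)" for c :: complex
  by (rule bounded_linear_intro[of _ "cmod c"])
    (simp_all add: scaleC_add_right scaleR_eq_scaleC scaleC_scaleC norm_scaleC mult.commute)

lemma cinner_rescaled_self:
  fixes x :: "'a::chilbert_space"
  assumes "x \<noteq> 0"
  shows "cinner (complex_of_real (s / norm x) *\<^sub>C x) (complex_of_real (s / norm x) *\<^sub>C x) =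
    complex_of_real (s\<^sup>2)"
  unfolding cinner_scaleC_left cinner_scaleC_right
  using assms by (simp add: cinner_self_norm power2_eq_square)

lemma norm_add_orth:
  fixes x y :: "'a::chilbert_space"
  assumes "cinner x y = 0"
  shows "(norm (x + y))\<^sup>2 = (norm x)\<^sup>2 + (norm y)\<^sup>2"
proof -
  have "inner x y = 0" using assms by (simp add: inner_eq_Re_cinner)
  thus ?thesis by (simp add: power2_norm_eq_inner inner_add inner_commute)
qed

text \<open>Otherwise the component of \<open>y\<close> orthogonal to \<open>x\<close> would be a forbidden \<open>w\<close>.\<close>

lemma parallel_if_double_perp:
  assumes "\<And>w. cinner w x = 0 \<Longrightarrow> cinner w y = 0"
  shows "\<exists>c. y = c *\<^sub>C (x :: 'a::chilbert_space)"
proof (cases "x = 0")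
  case True
  thus ?thesis using assms[of y] by simp
next
  case False
  define w where "w = y - (cinner y x / cinner x x) *\<^sub>C x"
  have wx: "cinner w x = 0" using False by (simp add: w_def cinner_linear)
  hence "cinner w y = 0" by (rule assms)
  hence "cinner w w = 0" using wx by (subst (2) w_def) (simp add: cinner_linear)
  hence "y = (cinner y x / cinner x x) *\<^sub>C x" by (simp add: w_def)
  thus ?thesis by blast
qed

text \<open>
  Three independent vectors cannot all lie in the span of \<open>a\<close> and \<open>b\<close>; the component of one of them
  orthogonal to that span is the required \<open>w\<close>.
\<close>

lemma exists_orth_to_two:
  assumes "\<exists>S :: 'h::chilbert_space set. complex_vector.independent S \<and> card S = 3"
  shows "\<exists>w::'h. w \<noteq> 0 \<and> cinner w a = 0 \<and> cinner w b = 0"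
proof -
  obtain S :: "'h set" where S: "complex_vector.independent S" "card S = 3" using assms by blast
  \<comment> \<open>Gram--Schmidt; if \<open>a\<close> or \<open>b'\<close> is zero, its coefficient is a division by zero and drops out\<close>
  define b' where "b' = b - (cinner b a / cinner a a) *\<^sub>C a"
  have b: "b = b' + (cinner b a / cinner a a) *\<^sub>C a" by (simp add: b'_def)
  have b'a: "cinner b' a = 0" by (cases "a = 0") (simp_all add: b'_def cinner_linear)
  hence ab': "cinner a b' = 0" using cinner_eq_0_commute by blast
  have "card {a, b'} \<le> 2" by (simp add: card_insert_if)
  hence "\<not> S \<subseteq> complex_vector.span {a, b'}"
    using complex_vector.independent_span_bound[of "{a, b'}" S] S by auto
  then obtain s where s: "s \<notin> complex_vector.span {a, b'}" by blast
  define w where "w = s - ((cinner s a / cinner a a) *\<^sub>C a + (cinner s b' / cinner b' b') *\<^sub>C b')"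
  have "w \<noteq> 0"
  proof
    assume "w = 0"
    hence "s = (cinner s a / cinner a a) *\<^sub>C a + (cinner s b' / cinner b' b') *\<^sub>C b'"
      by (simp add: w_def)
    also have "\<dots> \<in> complex_vector.span {a, b'}"
      by (intro complex_vector.span_add complex_vector.span_scale complex_vector.span_base) auto
    finally show False using s by simp
  qed
  moreover have wa: "cinner w a = 0"
    by (cases "a = 0") (simp_all add: w_def cinner_linear b'a)
  moreover have "cinner w b' = 0"
    by (cases "b' = 0") (simp_all add: w_def cinner_linear ab')
  hence "cinner w b = 0" using wa by (subst b) (simp add: cinner_linear)
  ultimately show ?thesis by blast
qed

section \<open>The Riesz representation theorem and adjoints\<close>

text \<open>
  The representing vector minimises the functional \<open>\<parallel>x\<parallel>\<^sup>2 - 2 g x\<close>: by the parallelogram law every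
  minimising sequence is Cauchy, and the first variation at a minimum \<open>h\<close> is
  \<open>2 (\<langle>h, z\<rangle> - g z)\<close>, which must vanish.
\<close>

lemma riesz_real:
  fixes g :: "'a::{real_inner, complete_space} \<Rightarrow> real"
  assumes "bounded_linear g"
  shows "\<exists>h. \<forall>z. g z = inner z h"
proof -
  interpret g: bounded_linear g by fact
  define Q where "Q x = inner x x - 2 * g x" for x
  define m where "m = Inf (range Q)"
  have parallelogram: "Q x + Q y = 2 * Q ((1/2) *\<^sub>R (x + y)) + (norm (x - y))\<^sup>2 / 2" for x y
    unfolding Q_def g.scaleR g.add power2_norm_eq_inner
    by (simp add: inner_add inner_diff inner_commute[of y x] field_simps)
  have bdd: "bdd_below (range Q)"
  proof -
    obtain K where K: "\<And>x. norm (g x) \<le> norm x * K"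
      using g.bounded by blast
    have "Q x \<ge> - K\<^sup>2" for x
    proof -
      have "g x \<le> norm x * K" using K[of x] by simp
      moreover have "(norm x)\<^sup>2 - 2 * (norm x * K) + K\<^sup>2 \<ge> 0"
        using zero_le_power2[of "norm x - K"] by (simp add: power2_diff)
      ultimately show ?thesis
        unfolding Q_def power2_norm_eq_inner[symmetric] by linarith
    qed
    thus ?thesis by (auto intro!: bdd_belowI)
  qed
  have m_le: "m \<le> Q x" for x
    unfolding m_def using bdd by (intro cInf_lower) auto
  have "\<exists>x. Q x < m + inverse (real (Suc n))" for n
    using cInf_lessD[of "range Q" "m + inverse (real (Suc n))"] by (auto simp: m_def)
  then obtain X where X: "\<And>n. Q (X n) < m + inverse (real (Suc n))" by metis
  have dist_X: "(norm (X i - X j))\<^sup>2 \<le> 4 * inverse (real (Suc n))" if "n \<le> i" "n \<le> j" for i j n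
  proof -
    have "inverse (real (Suc i)) \<le> inverse (real (Suc n))"
      and "inverse (real (Suc j)) \<le> inverse (real (Suc n))"
      using that by (auto intro: le_imp_inverse_le)
    thus ?thesis
      using parallelogram[of "X i" "X j"] X[of i] X[of j] m_le[of "(1/2) *\<^sub>R (X i + X j)"]
      by linarith
  qed
  have "Cauchy X"
  proof (rule CauchyI)
    fix r :: real assume "0 < r"
    then obtain n where n: "inverse (real (Suc n)) < r\<^sup>2 / 4"
      using reals_Archimedean[of "r\<^sup>2 / 4"] by auto
    have "norm (X i - X j) < r" if "n \<le> i" "n \<le> j" for i j
    proof (rule power2_less_imp_less)
      show "(norm (X i - X j))\<^sup>2 < r\<^sup>2"
        using dist_X[OF that] n by linarith
    qed (use \<open>0 < r\<close> in simp)
    thus "\<exists>M. \<forall>i\<ge>M. \<forall>j\<ge>M. norm (X i - X j) < r" by blast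
  qed
  then obtain h where h: "X \<longlonglongrightarrow> h"
    using Cauchy_convergent convergent_def by blast
  have "(\<lambda>n. Q (X n)) \<longlonglongrightarrow> Q h"
    unfolding Q_def by (intro tendsto_intros h g.tendsto)
  moreover have "(\<lambda>n. m + inverse (real (Suc n))) \<longlonglongrightarrow> m + 0"
    by (intro tendsto_add tendsto_const LIMSEQ_inverse_real_of_nat)
  ultimately have "Q h \<le> m"
    using LIMSEQ_le[of "\<lambda>n. Q (X n)" "Q h" _ "m + 0"] X by (force intro: less_imp_le)
  have "g z = inner z h" for z
  proof (rule ccontr)
    define d where "d = inner z h - g z"
    assume "g z \<noteq> inner z h"
    hence "d \<noteq> 0" by (simp add: d_def)
    hence "z \<noteq> 0" by (auto simp: d_def g.zero)
    hence zz: "inner z z > 0" by simp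
    define t where "t = - d / inner z z"
    \<comment> \<open>the minimum of the quadratic polynomial \<open>t \<mapsto> Q (h + t z)\<close>, whose value lies below \<open>Q h\<close>\<close>
    have "Q (h + t *\<^sub>R z) = Q h + (2 * t * d + t\<^sup>2 * inner z z)"
      by (simp add: Q_def d_def g.add g.scaleR inner_add inner_commute power2_eq_square algebra_simps)
    moreover have "2 * t * d + t\<^sup>2 * inner z z = - (d\<^sup>2 / inner z z)"
      using zz by (simp add: t_def power2_eq_square field_simps)
    moreover have "d\<^sup>2 / inner z z > 0" using \<open>d \<noteq> 0\<close> zz by simp
    ultimately show False
      using m_le[of "h + t *\<^sub>R z"] \<open>Q h \<le> m\<close> by linarith
  qed
  thus ?thesis by blast
qed

lemma riesz_complex:
  fixes g :: "'a::chilbert_space \<Rightarrow> complex"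
  assumes bl: "bounded_linear g" and lin: "\<And>c x. g (c *\<^sub>C x) = c * g x"
  shows "\<exists>h. \<forall>z. g z = cinner z h"
proof -
  obtain h where h: "\<And>z. Re (g z) = inner z h"
    using riesz_real[OF bounded_linear_compose[OF bounded_linear_Re bl]] by auto
  have "g z = cinner z h" for z
    \<comment> \<open>the imaginary part of \<open>g z\<close> is the real part of \<open>g (- \<i> z)\<close>\<close>
    using h[of z] h[of "(- \<i>) *\<^sub>C z"]
    unfolding inner_eq_Re_cinner cinner_linear lin by (simp add: complex_eq_iff)
  thus ?thesis by blast
qed

lemma bounded_opsD:
  assumes "A \<in> bounded_ops"
  shows "bounded_linear A" "A (c *\<^sub>C x) = c *\<^sub>C A x"
  using assms by (auto simp: bounded_ops_def)

lemma cinner_cadjoint: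
  assumes "A \<in> bounded_ops"
  shows "cinner (A x) y = cinner x (cadjoint A y)"
proof -
  have "\<exists>h. \<forall>z. cinner (A z) y = cinner z h" for y
    using assms
    by (intro riesz_complex bounded_linear_compose[OF bounded_linear_cinner_left])
      (auto simp: bounded_ops_def cinner_linear)
  then obtain B where "\<forall>x y. cinner (A x) y = cinner x (B y)" by metis
  hence "\<exists>B. \<forall>x y. cinner (A x) y = cinner x (B y)" by blast
  from someI_ex[OF this] show ?thesis unfolding cadjoint_def by blast
qed

text \<open>This translates the hypothesis on \<open>\<Phi>\<close> into geometry.\<close>

lemma cadjoint_comp_eq_0_iff:
  assumes "A \<in> bounded_ops"
  shows "cadjoint A \<circ> B = (\<lambda>_. 0) \<longleftrightarrow> (\<forall>x y. cinner (A x) (B y) = 0)"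
proof
  assume "\<forall>x y. cinner (A x) (B y) = 0"
  hence "cinner (cadjoint A (B y)) (cadjoint A (B y)) = 0" for y
    unfolding cinner_cadjoint[OF assms, symmetric] by blast
  thus "cadjoint A \<circ> B = (\<lambda>_. 0)" by (auto simp: fun_eq_iff)
next
  assume "cadjoint A \<circ> B = (\<lambda>_. 0)"
  thus "\<forall>x y. cinner (A x) (B y) = 0"
    by (simp add: cinner_cadjoint[OF assms] fun_eq_iff o_def)
qed

text \<open>An isometry that is onto has its inverse as an adjoint, and adjoints are unique.\<close>

lemma unitary_opI:
  assumes add: "\<And>x y. U (x + y) = U x + U y" and scale: "\<And>c x. U (c *\<^sub>C x) = c *\<^sub>C U x"
    and iso: "\<And>x y. cinner (U x) (U y) = cinner x y" and surj: "surj U"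
  shows "unitary_op (U :: 'a::chilbert_space \<Rightarrow> 'a)"
proof -
  have norm: "norm (U x) = norm x" for x
    by (simp add: norm_eq_sqrt_inner inner_eq_Re_cinner iso)
  have "bounded_linear U"
    by (rule bounded_linear_intro[of _ 1]) (simp_all add: add scale norm scaleR_eq_scaleC)
  hence U: "U \<in> bounded_ops" by (simp add: bounded_ops_def scale)
  have left: "cadjoint U (U x) = x" for x
  proof -
    have "cinner z (cadjoint U (U x) - x) = 0" for z
      by (simp only: cinner_diff_right cinner_cadjoint[OF U, symmetric] iso diff_self)
    from this[of "cadjoint U (U x) - x"] show ?thesis by simp
  qed
  have "U (cadjoint U y) = y" for y
    using surjD[OF surj, of y] left by auto
  thus ?thesis using U left by (auto simp: unitary_op_def fun_eq_iff)
qed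

section \<open>Rank one operators\<close>

lemma rank_one_tensor:
  assumes "x \<noteq> 0" "f \<noteq> 0"
  shows "x \<otimes>\<^sub>o f \<in> rank_one_ops"
proof -
  have "bounded_linear (x \<otimes>\<^sub>o f)"
  proof -
    obtain K where K: "\<And>z. norm (cinner z f) \<le> norm z * K"
      using bounded_linear.bounded[OF bounded_linear_cinner_left[of f]] by blast
    show ?thesis
    proof (rule bounded_linear_intro)
      show "norm ((x \<otimes>\<^sub>o f) z) \<le> norm z * (K * norm x)" for z
        using mult_right_mono[OF K[of z], of "norm x"] by (simp add: tensor_op_def norm_scaleC mult.assoc)
    qed (simp_all add: tensor_op_def cinner_linear scaleC_add_left scaleC_scaleC scaleR_eq_scaleC)
  qed
  moreover have "(x \<otimes>\<^sub>o f) (c *\<^sub>C z) = c *\<^sub>C (x \<otimes>\<^sub>o f) z" for c z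
    by (simp add: tensor_op_def cinner_linear scaleC_scaleC)
  moreover have "range (x \<otimes>\<^sub>o f) = complex_vector.span {x}"
  proof -
    have "c *\<^sub>C x = (x \<otimes>\<^sub>o f) ((c / cinner f f) *\<^sub>C f)" for c
      using assms by (simp add: tensor_op_def cinner_linear)
    hence "range (\<lambda>c. c *\<^sub>C x) \<subseteq> range (x \<otimes>\<^sub>o f)" by blast
    thus ?thesis
      unfolding complex_vector.span_singleton by (auto simp: tensor_op_def)
  qed
  moreover have "complex_vector.dim {x} = 1"
    by (subst complex_vector.dim_eq_card_independent) (use assms in auto)
  ultimately show ?thesis by (simp add: rank_one_ops_def bounded_ops_def)
qed

lemma tensor_scale_left: "(c *\<^sub>C x) \<otimes>\<^sub>o f = x \<otimes>\<^sub>o (cnj c *\<^sub>C f)" for x :: "'a::chilbert_space"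
  by (rule ext) (simp add: tensor_op_def cinner_scaleC_right scaleC_scaleC mult.commute)

text \<open>The coefficient \<open>\<langle>A z, x\<rangle> / \<langle>x, x\<rangle>\<close> of \<open>A z\<close> along \<open>x\<close> is a functional of \<open>z\<close> that the adjoint represents.\<close>

lemma range_in_line_imp_tensor:
  assumes A: "A \<in> bounded_ops" and x: "x \<noteq> 0" and line: "\<And>z. \<exists>c. A z = c *\<^sub>C x"
  shows "A = x \<otimes>\<^sub>o ((1 / cinner x x) *\<^sub>C cadjoint A x)"
proof
  fix z
  obtain c where c: "A z = c *\<^sub>C x" using line by blast
  have "cinner z (cadjoint A x) = c * cinner x x"
    by (simp add: cinner_cadjoint[OF A, symmetric] c cinner_linear)
  moreover have "cnj (cinner x x) = cinner x x" by (metis cinner_commute)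
  ultimately show "A z = (x \<otimes>\<^sub>o ((1 / cinner x x) *\<^sub>C cadjoint A x)) z"
    using x by (simp add: c tensor_op_def cinner_linear)
qed

lemma rank_one_iff_tensor:
  "A \<in> rank_one_ops \<longleftrightarrow> (\<exists>x f. x \<noteq> 0 \<and> f \<noteq> 0 \<and> A = x \<otimes>\<^sub>o f)"
proof
  assume A: "A \<in> rank_one_ops"
  hence bA: "A \<in> bounded_ops" by (simp add: rank_one_ops_def)
  obtain B where B: "range A \<subseteq> complex_vector.span B" "card B = complex_vector.dim (range A)"
    by (rule complex_vector.basis_exists)
  have "card B = 1" using A B(2) by (simp add: rank_one_ops_def)
  then obtain x where Bx: "B = {x}" by (auto simp: card_1_singleton_iff)
  have line: "\<exists>c. A z = c *\<^sub>C x" for z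
    using B(1) unfolding Bx complex_vector.span_singleton by blast
  have "\<exists>z. A z \<noteq> 0"
  proof (rule ccontr)
    assume "\<not> (\<exists>z. A z \<noteq> 0)"
    hence "range A = complex_vector.span {}" by auto
    hence "complex_vector.dim (range A) = card ({} :: 'a set)"
      by (simp only: complex_vector.dim_span
          complex_vector.dim_eq_card_independent[OF complex_vector.independent_empty])
    thus False using A by (simp add: rank_one_ops_def)
  qed
  then obtain z where z: "A z \<noteq> 0" by blast
  hence "x \<noteq> 0" using line[of z] by auto
  moreover obtain f where f: "A = x \<otimes>\<^sub>o f"
    using range_in_line_imp_tensor[OF bA \<open>x \<noteq> 0\<close> line] by blast
  moreover have "f \<noteq> 0" using z f by (auto simp: tensor_op_def)
  ultimately show "\<exists>x f. x \<noteq> 0 \<and> f \<noteq> 0 \<and> A = x \<otimes>\<^sub>o f" by blast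
qed (auto intro: rank_one_tensor)

definition range_orth :: "('a::chilbert_space \<Rightarrow> 'a) \<Rightarrow> ('a \<Rightarrow> 'a) \<Rightarrow> bool" where
  "range_orth A B \<longleftrightarrow> (\<forall>x y. cinner (A x) (B y) = 0)"

text \<open>
  When \<open>S\<close> contains the rank one operators, this is inclusion of the closed ranges. It is phrased
  through \<open>range_orth\<close> because a map that respects \<open>range_orth\<close> and is onto then respects it too.
\<close>

definition dominated :: "('a::chilbert_space \<Rightarrow> 'a) set \<Rightarrow> ('a \<Rightarrow> 'a) \<Rightarrow> ('a \<Rightarrow> 'a) \<Rightarrow> bool" where
  "dominated S C A \<longleftrightarrow> (\<forall>D\<in>S. range_orth A D \<longrightarrow> range_orth C D)"

lemma range_orth_self_iff: "range_orth A A \<longleftrightarrow> A = (\<lambda>_. 0)"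
proof
  assume "range_orth A A"
  hence "cinner (A z) (A z) = 0" for z unfolding range_orth_def by blast
  thus "A = (\<lambda>_. 0)" by (simp add: fun_eq_iff)
qed (simp add: range_orth_def)

lemma range_orth_tensor_iff:
  assumes "f \<noteq> 0" "g \<noteq> 0"
  shows "range_orth (x \<otimes>\<^sub>o f) (y \<otimes>\<^sub>o g) \<longleftrightarrow> cinner x y = 0"
proof
  assume "range_orth (x \<otimes>\<^sub>o f) (y \<otimes>\<^sub>o g)"
  hence "cinner ((x \<otimes>\<^sub>o f) f) ((y \<otimes>\<^sub>o g) g) = 0" by (simp add: range_orth_def)
  thus "cinner x y = 0" using assms by (simp add: tensor_op_def cinner_linear)
qed (simp add: range_orth_def tensor_op_def cinner_linear)

text \<open>Every \<open>w\<close> orthogonal to \<open>x\<close> provides a test operator \<open>w \<otimes>\<^sub>o w\<close>.\<close>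

lemma dominated_tensor_imp_line:
  assumes S: "rank_one_ops \<subseteq> S" and x: "f \<noteq> 0" and dom: "dominated S A (x \<otimes>\<^sub>o f)"
  shows "\<exists>c. A z = c *\<^sub>C x"
proof (rule parallel_if_double_perp)
  fix w assume wx: "cinner w x = 0"
  show "cinner w (A z) = 0"
  proof (cases "w = 0")
    case False
    hence "w \<otimes>\<^sub>o w \<in> S" using S rank_one_tensor by blast
    moreover have "range_orth (x \<otimes>\<^sub>o f) (w \<otimes>\<^sub>o w)"
      using x False wx by (simp add: range_orth_tensor_iff cinner_eq_0_commute[of x])
    ultimately have "range_orth A (w \<otimes>\<^sub>o w)" using dom by (simp add: dominated_def)
    hence "cinner (A z) ((w \<otimes>\<^sub>o w) w) = 0" by (simp add: range_orth_def)
    thus ?thesis using False by (simp add: tensor_op_def cinner_linear cinner_eq_0_commute[of w])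
  qed simp
qed

lemma dominated_tensorI:
  assumes "f \<noteq> 0" "\<And>z. \<exists>c. A z = c *\<^sub>C x"
  shows "dominated S A (x \<otimes>\<^sub>o f)"
  unfolding dominated_def
proof (intro ballI impI)
  fix D assume "range_orth (x \<otimes>\<^sub>o f) D"
  hence "cinner ((x \<otimes>\<^sub>o f) f) (D y) = 0" for y by (simp add: range_orth_def)
  hence "cinner x (D y) = 0" for y
    using assms(1) by (simp add: tensor_op_def cinner_linear)
  thus "range_orth A D"
    unfolding range_orth_def using assms(2) by (metis cinner_scaleC_left mult_zero_right)
qed

lemma dominated_range_subset:
  assumes "\<And>z. \<exists>w. C z = A w"
  shows "dominated S C A"
  unfolding dominated_def range_orth_def
proof (intro ballI impI allI)
  fix D z y assume "\<forall>x y. cinner (A x) (D y) = 0"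
  thus "cinner (C z) (D y) = 0" using assms[of z] by auto
qed

text \<open>
  For minimality of \<open>x \<otimes>\<^sub>o f\<close>: a nonzero operator whose range lies in the line of \<open>x\<close> has the whole
  line as its range. Conversely a nonzero \<open>A\<close> dominates the operators \<open>x \<otimes>\<^sub>o x\<close> with \<open>x\<close> in the
  range of \<open>A\<close>, and a minimal \<open>A\<close> is therefore dominated by one of them.
\<close>

lemma rank_one_iff_minimal:
  assumes S: "rank_one_ops \<subseteq> S" "S \<subseteq> bounded_ops" and A: "A \<in> S"
  shows "A \<in> rank_one_ops \<longleftrightarrow> \<not> range_orth A A \<and>
    (\<forall>C\<in>S. \<not> range_orth C C \<and> dominated S C A \<longrightarrow> dominated S A C)"
proof (intro iffI conjI ballI impI)
  assume "A \<in> rank_one_ops"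
  then obtain x f where xf: "x \<noteq> 0" "f \<noteq> 0" "A = x \<otimes>\<^sub>o f"
    by (auto simp: rank_one_iff_tensor)
  thus "\<not> range_orth A A" by (simp add: range_orth_tensor_iff)
  fix C assume "C \<in> S" and C: "\<not> range_orth C C \<and> dominated S C A"
  then obtain z where z: "C z \<noteq> 0" by (auto simp: range_orth_self_iff fun_eq_iff)
  obtain c where c: "C z = c *\<^sub>C x"
    using dominated_tensor_imp_line[OF S(1) xf(2)] C xf(3) by blast
  have "c \<noteq> 0" using z c by auto
  have "C ((d / c) *\<^sub>C z) = d *\<^sub>C x" for d
    using bounded_opsD(2)[of C] \<open>C \<in> S\<close> S(2) c \<open>c \<noteq> 0\<close> by (auto simp: scaleC_scaleC)
  hence "\<exists>w. A y = C w" for y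
    unfolding xf(3) tensor_op_def by metis
  thus "dominated S A C" by (rule dominated_range_subset)
next
  assume min: "\<not> range_orth A A \<and>
    (\<forall>C\<in>S. \<not> range_orth C C \<and> dominated S C A \<longrightarrow> dominated S A C)"
  then obtain z where z: "A z \<noteq> 0" by (auto simp: range_orth_self_iff fun_eq_iff)
  define x where "x = A z"
  have x: "x \<noteq> 0" using z by (simp add: x_def)
  have bA: "A \<in> bounded_ops" using A S by blast
  have "(x \<otimes>\<^sub>o x) y = A (cinner y x *\<^sub>C z)" for y
    by (simp add: tensor_op_def bounded_opsD(2)[OF bA] flip: x_def)
  hence "dominated S (x \<otimes>\<^sub>o x) A" by (intro dominated_range_subset) blast
  moreover have "\<not> range_orth (x \<otimes>\<^sub>o x) (x \<otimes>\<^sub>o x)" using x by (simp add: range_orth_tensor_iff)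
  moreover have "x \<otimes>\<^sub>o x \<in> S" using S(1) rank_one_tensor x by blast
  ultimately have "dominated S A (x \<otimes>\<^sub>o x)" using min by blast
  hence line: "\<exists>c. A y = c *\<^sub>C x" for y by (rule dominated_tensor_imp_line[OF S(1) x])
  obtain f where f: "A = x \<otimes>\<^sub>o f" using range_in_line_imp_tensor[OF bA x line] by blast
  moreover have "f \<noteq> 0" using z f by (auto simp: tensor_op_def)
  ultimately show "A \<in> rank_one_ops" using x by (auto simp: rank_one_iff_tensor)
qed

section \<open>Field endomorphisms of the complex numbers\<close>

text \<open>
  Nonnegativity makes the endomorphism monotone on the reals, where it fixes the rationals and
  hence everything; the image of \<open>\<i>\<close> is then a square root of \<open>-1\<close>.
\<close>

lemma complex_endomorphism_id_or_cnj:
  fixes \<sigma> :: "complex \<Rightarrow> complex"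
  assumes add: "\<And>x y. \<sigma> (x + y) = \<sigma> x + \<sigma> y" and mult: "\<And>x y. \<sigma> (x * y) = \<sigma> x * \<sigma> y"
    and one: "\<sigma> 1 = 1"
    and nonneg: "\<And>r. 0 \<le> r \<Longrightarrow> \<exists>s\<ge>0. \<sigma> (complex_of_real r) = complex_of_real s"
  shows "\<sigma> = (\<lambda>z. z) \<or> \<sigma> = cnj"
proof -
  have zero: "\<sigma> 0 = 0" using add[of 0 0] by simp
  have minus: "\<sigma> (- x) = - \<sigma> x" for x
    using add[of x "- x"] zero by (simp add: add_eq_0_iff)
  have real: "\<exists>s. \<sigma> (complex_of_real r) = complex_of_real s" for r
  proof (cases "0 \<le> r")
    case False
    then obtain s where "\<sigma> (complex_of_real (- r)) = complex_of_real s" using nonneg[of "- r"] by auto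
    hence "\<sigma> (complex_of_real r) = complex_of_real (- s)" using minus[of "complex_of_real r"]
      by (metis minus_minus of_real_minus)
    thus ?thesis by blast
  qed (use nonneg in blast)
  then obtain g where g: "\<And>r. \<sigma> (complex_of_real r) = complex_of_real (g r)" by metis
  have g_add: "g (x + y) = g x + g y" for x y
    using add[of "complex_of_real x" "complex_of_real y"]
    by (simp only: g of_real_add[symmetric] of_real_eq_iff)
  have g_mult: "g (x * y) = g x * g y" for x y
    using mult[of "complex_of_real x" "complex_of_real y"]
    by (simp only: g of_real_mult[symmetric] of_real_eq_iff)
  have g_one: "g 1 = 1" using g[of 1] one by simp
  have g_zero: "g 0 = 0" using g_add[of 0 0] by simp
  have g_minus: "g (- x) = - g x" for x using g_add[of x "- x"] g_zero by simp
  have g_nonneg: "0 \<le> g r" if "0 \<le> r" for r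
    using nonneg[OF that] g[of r] by auto
  have g_mono: "g x \<le> g y" if "x \<le> y" for x y
    using g_add[of x "y - x"] g_nonneg[of "y - x"] that by simp
  have g_nat: "g (real n) = real n" for n
    by (induction n) (simp_all add: g_zero g_add g_one)
  have g_int: "g (real_of_int k) = real_of_int k" for k
  proof (cases k)
    case (neg n)
    thus ?thesis using g_minus[of "real (Suc n)"] g_nat[of "Suc n"] by simp
  qed (simp add: g_nat)
  have g_rat: "g q = q" if rat: "q \<in> \<rat>" for q
  proof -
    obtain a b :: int where b: "b > 0" and q: "q = real_of_int a / real_of_int b"
      by (rule Rats_cases'[OF rat])
    have "g q * real_of_int b = real_of_int a"
      using g_mult[of q "real_of_int b"] b q by (simp add: g_int)
    hence "g q = real_of_int a / real_of_int b" using b by (simp add: eq_divide_eq)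
    thus ?thesis using q by simp
  qed
  have g_id: "g r = r" for r
  proof (rule ccontr)
    assume "g r \<noteq> r"
    then consider "g r < r" | "r < g r" by linarith
    thus False
    proof cases
      case 1
      then obtain q where "q \<in> \<rat>" "g r < q" "q < r" using Rats_dense_in_real by blast
      thus False using g_mono[of q r] g_rat[of q] by simp
    next
      case 2
      then obtain q where "q \<in> \<rat>" "r < q" "q < g r" using Rats_dense_in_real by blast
      thus False using g_mono[of r q] g_rat[of q] by simp
    qed
  qed
  have "\<sigma> \<i> * \<sigma> \<i> = - 1" using mult[of \<i> \<i>] minus[of 1] one by simp
  hence "(\<sigma> \<i> - \<i>) * (\<sigma> \<i> + \<i>) = 0" by (simp add: algebra_simps)
  hence i: "\<sigma> \<i> = \<i> \<or> \<sigma> \<i> = - \<i>" by (auto simp: add_eq_0_iff2)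
  have \<sigma>: "\<sigma> z = complex_of_real (Re z) + \<sigma> \<i> * complex_of_real (Im z)" for z
    by (subst complex_eq[of z]) (simp only: add mult g g_id)
  from i show ?thesis
  proof
    assume "\<sigma> \<i> = \<i>"
    hence "\<sigma> z = z" for z unfolding \<sigma>[of z] by (simp add: complex_eq_iff)
    thus ?thesis by blast
  next
    assume "\<sigma> \<i> = - \<i>"
    hence "\<sigma> z = cnj z" for z unfolding \<sigma>[of z] by (simp add: complex_eq_iff)
    thus ?thesis by blast
  qed
qed

section \<open>Maps of lines that preserve orthogonality\<close>

text \<open>
  A map of the lines is given by a choice of a nonzero vector \<open>p x\<close> on the image of the line of \<open>x\<close>, so
  the conclusions about \<open>p x\<close> are up to a scalar. The first assumption says that the dimension is at
  least three.
\<close>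

locale line_orth_map =
  fixes p :: "'h::chilbert_space \<Rightarrow> 'h"
  assumes dim_ge_3: "\<And>a b. \<exists>w::'h. w \<noteq> 0 \<and> cinner w a = 0 \<and> cinner w b = 0"
    and p_nonzero: "\<And>x. x \<noteq> 0 \<Longrightarrow> p x \<noteq> 0"
    and p_orth: "\<And>x y. x \<noteq> 0 \<Longrightarrow> y \<noteq> 0 \<Longrightarrow> cinner (p x) (p y) = 0 \<longleftrightarrow> cinner x y = 0"
    and p_onto: "\<And>y. y \<noteq> 0 \<Longrightarrow> \<exists>x c. x \<noteq> 0 \<and> y = c *\<^sub>C p x"
begin

text \<open>
  A plane is its own double orthogonal complement, and \<open>p\<close> preserves orthogonal complements of sets
  of lines because it is onto.
\<close>

lemma p_plane:
  assumes a: "a \<noteq> 0" and b: "b \<noteq> 0" and ab: "cinner a b = 0" and x: "x \<noteq> 0" "x = \<alpha> *\<^sub>C a + \<beta> *\<^sub>C b"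
  shows "\<exists>\<gamma> \<delta>. p x = \<gamma> *\<^sub>C p a + \<delta> *\<^sub>C p b"
proof -
  define \<gamma> where "\<gamma> = cinner (p x) (p a) / cinner (p a) (p a)"
  define \<delta> where "\<delta> = cinner (p x) (p b) / cinner (p b) (p b)"
  define d where "d = p x - (\<gamma> *\<^sub>C p a + \<delta> *\<^sub>C p b)"
  have pab: "cinner (p a) (p b) = 0" "cinner (p b) (p a) = 0"
    using p_orth[OF a b] p_orth[OF b a] ab cinner_eq_0_commute[of a b] by auto
  have da: "cinner d (p a) = 0" and db: "cinner d (p b) = 0"
    using p_nonzero[OF a] p_nonzero[OF b] pab by (simp_all add: d_def \<gamma>_def \<delta>_def cinner_linear)
  have "d = 0"
  proof (rule ccontr)
    assume "d \<noteq> 0"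
    then obtain w c where w: "w \<noteq> 0" and dw: "d = c *\<^sub>C p w" using p_onto by blast
    have "c \<noteq> 0" using \<open>d \<noteq> 0\<close> dw by auto
    hence "cinner (p w) (p a) = 0" "cinner (p w) (p b) = 0"
      using da db by (simp_all add: dw cinner_linear)
    hence "cinner w a = 0" "cinner w b = 0" using p_orth w a b by auto
    hence "cinner w x = 0" by (simp add: x(2) cinner_linear)
    hence "cinner d (p x) = 0" using p_orth[OF w x(1)] by (simp add: dw cinner_linear)
    hence "cinner d d = 0" using da db by (subst (2) d_def) (simp add: cinner_linear)
    thus False using \<open>d \<noteq> 0\<close> by simp
  qed
  thus ?thesis unfolding d_def by (metis eq_iff_diff_eq_0)
qed

lemma p_scale:
  assumes x: "x \<noteq> 0" and c: "c \<noteq> 0"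
  shows "\<exists>k. k \<noteq> 0 \<and> p (c *\<^sub>C x) = k *\<^sub>C p x"
proof -
  obtain b where b: "b \<noteq> 0" "cinner b x = 0" using dim_ge_3[of x x] by auto
  have cx: "c *\<^sub>C x \<noteq> 0" using x c by simp
  have xb: "cinner x b = 0" using b(2) cinner_eq_0_commute by blast
  have "c *\<^sub>C x = c *\<^sub>C x + 0 *\<^sub>C b" by simp
  then obtain \<gamma> \<delta> where eq: "p (c *\<^sub>C x) = \<gamma> *\<^sub>C p x + \<delta> *\<^sub>C p b"
    using p_plane[OF x b(1) xb cx] by blast
  have "cinner (p (c *\<^sub>C x)) (p b) = 0" using p_orth[OF cx b(1)] xb by (simp add: cinner_linear)
  moreover have "cinner (p x) (p b) = 0" using p_orth[OF x b(1)] xb by simp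
  ultimately have "\<delta> = 0" using p_nonzero[OF b(1)] by (simp add: eq cinner_linear)
  hence "p (c *\<^sub>C x) = \<gamma> *\<^sub>C p x" using eq by simp
  moreover have "\<gamma> \<noteq> 0" using p_nonzero[OF cx] calculation by auto
  ultimately show ?thesis by blast
qed

end

text \<open>
  With a unit vector \<open>e1\<close> fixed, the lines that are not orthogonal to it form an affine chart
  parametrised by the \<open>v\<close> orthogonal to \<open>e1\<close>, through the line of \<open>e1 + v\<close>. The map \<open>T\<close> below is the line map read
  in this chart and in the corresponding chart around \<open>f1\<close>.
\<close>

locale line_orth_map_chart = line_orth_map p for p :: "'h::chilbert_space \<Rightarrow> 'h" +
  fixes e1 :: 'h
  assumes e1_unit: "cinner e1 e1 = 1"
begin

abbreviation K :: "'h \<Rightarrow> bool" where "K v \<equiv> cinner v e1 = 0"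

definition f1 :: 'h where "f1 = complex_of_real (1 / norm (p e1)) *\<^sub>C p e1"

definition T :: "'h \<Rightarrow> 'h" where
  "T v = (1 / cinner (p (e1 + v)) f1) *\<^sub>C p (e1 + v) - f1"

lemma e1_nonzero: "e1 \<noteq> 0"
  using e1_unit by auto

lemma f1_unit: "cinner f1 f1 = 1"
  unfolding f1_def cinner_rescaled_self[OF p_nonzero[OF e1_nonzero]] by simp

lemma K_commute: "K v \<Longrightarrow> cinner e1 v = 0"
  using cinner_eq_0_commute by blast

lemma chart_nonzero: "K v \<Longrightarrow> e1 + v \<noteq> 0"
  using e1_unit by (metis add.right_neutral cinner_add_left cinner_zero_left zero_neq_one)

lemma f1_T_parallel:
  assumes "K v"
  shows "\<exists>c. c \<noteq> 0 \<and> f1 + T v = c *\<^sub>C p (e1 + v)"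
proof -
  have "cinner (e1 + v) e1 \<noteq> 0" using assms e1_unit by (simp add: cinner_linear)
  hence "cinner (p (e1 + v)) (p e1) \<noteq> 0"
    using p_orth[OF chart_nonzero[OF assms] e1_nonzero] by simp
  hence "cinner (p (e1 + v)) f1 \<noteq> 0"
    using p_nonzero[OF e1_nonzero] by (simp add: f1_def cinner_linear)
  thus ?thesis by (intro exI[of _ "1 / cinner (p (e1 + v)) f1"]) (simp add: T_def)
qed

lemma T_perp_f1:
  assumes "K v"
  shows "cinner (T v) f1 = 0" "cinner f1 (T v) = 0"
proof -
  have "cinner (p (e1 + v)) f1 \<noteq> 0"
  proof
    assume 0: "cinner (p (e1 + v)) f1 = 0"
    hence "f1 + T v = 0" by (simp add: T_def)
    thus False using f1_T_parallel[OF assms] p_nonzero[OF chart_nonzero[OF assms]] by auto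
  qed
  thus "cinner (T v) f1 = 0" by (simp add: T_def cinner_linear f1_unit)
  thus "cinner f1 (T v) = 0" using cinner_eq_0_commute by blast
qed

lemma T_zero: "T 0 = 0"
proof -
  obtain c where c: "f1 + T 0 = c *\<^sub>C p e1" using f1_T_parallel[of 0] by auto
  have "p e1 = complex_of_real (norm (p e1)) *\<^sub>C f1"
    using p_nonzero[OF e1_nonzero] by (simp add: f1_def scaleC_scaleC scaleC_one)
  then obtain d where d: "f1 + T 0 = d *\<^sub>C f1" using c by (metis scaleC_scaleC)
  have "cinner (f1 + T 0) f1 = 1" using T_perp_f1[of 0] by (simp add: cinner_linear f1_unit)
  hence "d = 1" by (simp add: d cinner_linear f1_unit)
  thus ?thesis using d by (simp add: scaleC_one)
qed

text \<open>Orthogonality of the lines of \<open>e1 + v\<close> and \<open>e1 + w\<close> says that \<open>1 + \<langle>v, w\<rangle> = 0\<close>.\<close>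

lemma T_cinner_minus_1:
  assumes "K v" "K w"
  shows "cinner (T v) (T w) = - 1 \<longleftrightarrow> cinner v w = - 1"
proof -
  obtain c d where cd: "c \<noteq> 0" "f1 + T v = c *\<^sub>C p (e1 + v)" "d \<noteq> 0" "f1 + T w = d *\<^sub>C p (e1 + w)"
    using f1_T_parallel assms by metis
  have "cinner (f1 + T v) (f1 + T w) = 0 \<longleftrightarrow> cinner (e1 + v) (e1 + w) = 0"
    unfolding cd(2,4) using cd(1,3) p_orth[OF chart_nonzero chart_nonzero] assms
    by (simp add: cinner_linear)
  thus ?thesis
    using T_perp_f1[OF assms(1)] T_perp_f1[OF assms(2)] assms K_commute[OF assms(1)]
      K_commute[OF assms(2)]
    by (simp add: cinner_linear f1_unit e1_unit add_eq_0_iff)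
qed

text \<open>
  As \<open>e1 + v\<close> lies in the plane of \<open>e1\<close> and \<open>v\<close>, its image lies in the plane of \<open>f1\<close> and \<open>p v\<close>.
\<close>

lemma T_parallel:
  assumes v: "K v" "v \<noteq> 0"
  shows "\<exists>c. c \<noteq> 0 \<and> T v = c *\<^sub>C p v"
proof -
  obtain c where c: "c \<noteq> 0" "f1 + T v = c *\<^sub>C p (e1 + v)" using f1_T_parallel[OF v(1)] by blast
  have "e1 + v = 1 *\<^sub>C e1 + 1 *\<^sub>C v" by (simp add: scaleC_one)
  then obtain \<gamma> \<delta> where "p (e1 + v) = \<gamma> *\<^sub>C p e1 + \<delta> *\<^sub>C p v"
    using p_plane[OF e1_nonzero v(2) K_commute[OF v(1)] chart_nonzero[OF v(1)]] by blast
  moreover have "p e1 = complex_of_real (norm (p e1)) *\<^sub>C f1"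
    using p_nonzero[OF e1_nonzero] by (simp add: f1_def scaleC_scaleC scaleC_one)
  ultimately obtain \<gamma>' \<delta>' where eq: "f1 + T v = \<gamma>' *\<^sub>C f1 + \<delta>' *\<^sub>C p v"
    using c(2) by (metis scaleC_add_right scaleC_scaleC)
  have "cinner (p v) (p e1) = 0" using p_orth[OF v(2) e1_nonzero] v(1) by simp
  hence pvf: "cinner (p v) f1 = 0" by (simp add: f1_def cinner_linear)
  have "cinner (f1 + T v) f1 = 1" using T_perp_f1[OF v(1)] by (simp add: cinner_linear f1_unit)
  hence "\<gamma>' = 1" unfolding eq by (simp add: cinner_linear f1_unit pvf)
  hence Tv: "T v = \<delta>' *\<^sub>C p v" using eq by (simp add: scaleC_one)
  have "\<delta>' \<noteq> 0"
  proof
    assume "\<delta>' = 0"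
    hence "c *\<^sub>C p (e1 + v) = f1" using Tv c(2) by simp
    hence "cinner (c *\<^sub>C p (e1 + v)) (p v) = 0" using pvf cinner_eq_0_commute by metis
    hence "cinner (e1 + v) v = 0"
      using c(1) p_orth[OF chart_nonzero[OF v(1)] v(2)] by (simp add: cinner_linear)
    thus False using v K_commute[OF v(1)] by (simp add: cinner_linear)
  qed
  thus ?thesis using Tv by blast
qed

lemma T_nonzero: "K v \<Longrightarrow> v \<noteq> 0 \<Longrightarrow> T v \<noteq> 0"
  using T_parallel p_nonzero by fastforce

lemma T_orth:
  assumes "K v" "K w"
  shows "cinner (T v) (T w) = 0 \<longleftrightarrow> cinner v w = 0"
proof (cases "v = 0 \<or> w = 0")
  case False
  then obtain c d where "c \<noteq> 0" "T v = c *\<^sub>C p v" "d \<noteq> 0" "T w = d *\<^sub>C p w"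
    using T_parallel assms by metis
  thus ?thesis using False p_orth[of v w] by (simp add: cinner_linear)
qed (auto simp: T_zero)

lemma T_in_plane:
  assumes "K a" "K b" "a \<noteq> 0" "b \<noteq> 0" "cinner a b = 0" "x = \<alpha> *\<^sub>C a + \<beta> *\<^sub>C b"
  shows "\<exists>\<gamma> \<delta>. T x = \<gamma> *\<^sub>C T a + \<delta> *\<^sub>C T b"
proof (cases "x = 0")
  case True
  hence "T x = 0 *\<^sub>C T a + 0 *\<^sub>C T b" by (simp add: T_zero)
  thus ?thesis by blast
next
  case False
  have "K x" using assms by (simp add: cinner_linear)
  obtain ca where ca: "ca \<noteq> 0" "T a = ca *\<^sub>C p a" using T_parallel assms by metis
  obtain cb where cb: "cb \<noteq> 0" "T b = cb *\<^sub>C p b" using T_parallel assms by metis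
  obtain cx where cx: "T x = cx *\<^sub>C p x" using T_parallel[OF \<open>K x\<close> False] by blast
  obtain \<gamma> \<delta> where "p x = \<gamma> *\<^sub>C p a + \<delta> *\<^sub>C p b"
    using p_plane[OF assms(3,4,5) False assms(6)] by blast
  hence "T x = (cx * \<gamma> / ca) *\<^sub>C T a + (cx * \<delta> / cb) *\<^sub>C T b"
    using ca cb cx by (simp add: scaleC_add_right scaleC_scaleC)
  thus ?thesis by blast
qed

text \<open>
  The coefficients of \<open>T (a + b)\<close> are read off by pairing with \<open>T (- a / \<parallel>a\<parallel>\<^sup>2)\<close>, a multiple of
  \<open>T a\<close>, because \<open>a + b\<close> and \<open>a\<close> both have inner product \<open>- 1\<close> with \<open>- a / \<parallel>a\<parallel>\<^sup>2\<close>.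
\<close>

lemma T_add_orth:
  assumes a: "K a" and b: "K b" and ab: "cinner a b = 0"
  shows "T (a + b) = T a + T b"
proof (cases "a = 0 \<or> b = 0")
  case False
  hence nz: "a \<noteq> 0" "b \<noteq> 0" by auto
  have ba: "cinner b a = 0" using ab cinner_eq_0_commute by blast
  have sum: "K (a + b)" using a b by (simp add: cinner_linear)
  have "a + b = 1 *\<^sub>C a + 1 *\<^sub>C b" by (simp add: scaleC_one)
  then obtain \<gamma> \<delta> where eq: "T (a + b) = \<gamma> *\<^sub>C T a + \<delta> *\<^sub>C T b"
    using T_in_plane[OF a b nz ab] by blast
  have coeff: "\<gamma> = 1"
    if a: "K a" and b: "K b" and ba: "cinner b a = 0" and nz: "a \<noteq> 0" and sum: "K (a + b)"
      and eq: "T (a + b) = \<gamma> *\<^sub>C T a + \<delta> *\<^sub>C T b" for a b \<gamma> \<delta>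
  proof -
    define y where "y = (- 1 / cinner a a) *\<^sub>C a"
    have y: "K y" using a by (simp add: y_def cinner_linear)
    have aa: "cnj (cinner a a) = cinner a a" by (metis cinner_commute)
    have "cinner a y = - 1" "cinner (a + b) y = - 1" "cinner b y = 0"
      using nz ba aa by (simp_all add: y_def cinner_linear)
    hence "cinner (T a) (T y) = - 1" "cinner (T (a + b)) (T y) = - 1" "cinner (T b) (T y) = 0"
      using T_cinner_minus_1 T_orth a b y sum by blast+
    thus "\<gamma> = 1" by (simp add: eq cinner_linear)
  qed
  have "\<gamma> = 1" using coeff[OF a b ba nz(1) sum eq] .
  moreover have "\<delta> = 1"
    using coeff[OF b a ab nz(2), of \<delta> \<gamma>] sum eq unfolding add.commute[of b]
      add.commute[of "\<delta> *\<^sub>C T b"] by blast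
  ultimately show ?thesis using eq by (simp add: scaleC_one)
qed (auto simp: T_zero)

lemma T_scale_ex:
  assumes v: "K v"
  shows "\<exists>s. T (c *\<^sub>C v) = s *\<^sub>C T v"
proof (cases "v = 0 \<or> c = 0")
  case False
  have cv: "K (c *\<^sub>C v)" "c *\<^sub>C v \<noteq> 0" using v False by (auto simp: cinner_linear)
  obtain k where k: "k \<noteq> 0" "p (c *\<^sub>C v) = k *\<^sub>C p v" using p_scale False by metis
  obtain c1 where c1: "c1 \<noteq> 0" "T v = c1 *\<^sub>C p v" using T_parallel v False by metis
  obtain c2 where c2: "T (c *\<^sub>C v) = c2 *\<^sub>C p (c *\<^sub>C v)" using T_parallel[OF cv] by blast
  have "T (c *\<^sub>C v) = (c2 * k / c1) *\<^sub>C T v" using c1 by (simp add: c2 k scaleC_scaleC)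
  thus ?thesis by blast
next
  case True
  hence "T (c *\<^sub>C v) = 0 *\<^sub>C T v" by (auto simp: T_zero)
  thus ?thesis by blast
qed

text \<open>
  The vectors \<open>T (c a)\<close>, \<open>T (c b)\<close> and \<open>T (c (a + b))\<close> are multiples of \<open>T a\<close>, \<open>T b\<close> and \<open>T a + T b\<close>. As the
  third vector is the sum of the first two, the three factors agree.
\<close>

lemma T_scale_transfer:
  assumes a: "K a" "a \<noteq> 0" and b: "K b" and ab: "cinner a b = 0"
    and s: "T (c *\<^sub>C a) = s *\<^sub>C T a"
  shows "T (c *\<^sub>C b) = s *\<^sub>C T b"
proof (cases "b = 0")
  case False
  obtain s1 where s1: "T (c *\<^sub>C b) = s1 *\<^sub>C T b" using T_scale_ex[OF b] by blast
  have sum: "K (a + b)" using a b by (simp add: cinner_linear)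
  obtain s2 where s2: "T (c *\<^sub>C (a + b)) = s2 *\<^sub>C T (a + b)" using T_scale_ex[OF sum] by blast
  have "T (c *\<^sub>C (a + b)) = T (c *\<^sub>C a) + T (c *\<^sub>C b)"
    unfolding scaleC_add_right by (rule T_add_orth) (use a b ab in \<open>simp_all add: cinner_linear\<close>)
  hence eq: "s2 *\<^sub>C (T a + T b) = s *\<^sub>C T a + s1 *\<^sub>C T b"
    using s s1 s2 T_add_orth[OF a(1) b ab] by simp
  have orth: "cinner (T a) (T b) = 0" "cinner (T b) (T a) = 0"
    using T_orth[OF a(1) b] T_orth[OF b a(1)] ab cinner_eq_0_commute[of a b] by auto
  have "s2 = s"
    using arg_cong[OF eq, of "\<lambda>z. cinner z (T a)"] T_nonzero[OF a] orth by (simp add: cinner_linear)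
  moreover have "s2 = s1"
    using arg_cong[OF eq, of "\<lambda>z. cinner z (T b)"] T_nonzero[OF b False] orth
    by (simp add: cinner_linear)
  ultimately show ?thesis using s1 by simp
qed (simp add: T_zero)

text \<open>
  Any \<open>v\<close> is the sum of a multiple of a fixed \<open>v0\<close> and a vector orthogonal to \<open>v0\<close>, and
  \<open>T_scale_transfer\<close> passes the factor from \<open>v0\<close> to the second summand. It reaches the first one in
  two steps, through a vector \<open>b\<close> orthogonal to \<open>v0\<close>.
\<close>

lemma T_scale_uniform: "\<exists>\<sigma>. \<forall>v c. K v \<longrightarrow> T (c *\<^sub>C v) = \<sigma> c *\<^sub>C T v"
proof -
  obtain v0 where v0: "v0 \<noteq> 0" "K v0" using dim_ge_3[of e1 e1] by auto
  obtain b where b: "b \<noteq> 0" "cinner b e1 = 0" "cinner b v0 = 0" using dim_ge_3[of e1 v0] by auto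
  obtain \<sigma> where \<sigma>: "\<And>c. T (c *\<^sub>C v0) = \<sigma> c *\<^sub>C T v0" using T_scale_ex[OF v0(2)] by metis
  have v0b: "cinner v0 b = 0" using b(3) cinner_eq_0_commute by blast
  have "T (c *\<^sub>C v) = \<sigma> c *\<^sub>C T v" if v: "K v" for v c
  proof -
    define \<alpha> where "\<alpha> = cinner v v0 / cinner v0 v0"
    define d where "d = v - \<alpha> *\<^sub>C v0"
    have v_eq: "v = \<alpha> *\<^sub>C v0 + d" by (simp add: d_def)
    have Kd: "K d" and Ka: "K (\<alpha> *\<^sub>C v0)" using v v0 by (simp_all add: d_def cinner_linear)
    have "cinner d v0 = 0" using v0 by (simp add: d_def \<alpha>_def cinner_linear)
    hence v0d: "cinner v0 d = 0" using cinner_eq_0_commute by blast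
    have Td: "T (c *\<^sub>C d) = \<sigma> c *\<^sub>C T d" by (rule T_scale_transfer[OF v0(2,1) Kd v0d \<sigma>])
    have Tb: "T (c *\<^sub>C b) = \<sigma> c *\<^sub>C T b" by (rule T_scale_transfer[OF v0(2,1) b(2) v0b \<sigma>])
    \<comment> \<open>\<open>d\<close> cannot replace \<open>b\<close> here, as it may be zero\<close>
    have "T (c *\<^sub>C \<alpha> *\<^sub>C v0) = \<sigma> c *\<^sub>C T (\<alpha> *\<^sub>C v0)"
      by (rule T_scale_transfer[OF b(2,1) Ka _ Tb]) (simp add: b(3) cinner_linear)
    moreover have "T v = T (\<alpha> *\<^sub>C v0) + T d"
      by (subst v_eq, rule T_add_orth[OF Ka Kd]) (simp add: v0d cinner_linear)
    moreover have "T (c *\<^sub>C v) = T (c *\<^sub>C \<alpha> *\<^sub>C v0) + T (c *\<^sub>C d)"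
      by (subst v_eq, subst scaleC_add_right, rule T_add_orth)
        (use Ka Kd v0d v0 in \<open>simp_all add: cinner_linear\<close>)
    ultimately show ?thesis using Td by (simp add: scaleC_add_right)
  qed
  thus ?thesis by blast
qed

text \<open>The factor is unique because \<open>T\<close> has nonzero values.\<close>

definition \<sigma> :: "complex \<Rightarrow> complex" where
  "\<sigma> = (SOME \<sigma>. \<forall>v c. K v \<longrightarrow> T (c *\<^sub>C v) = \<sigma> c *\<^sub>C T v)"

lemma T_scale: "K v \<Longrightarrow> T (c *\<^sub>C v) = \<sigma> c *\<^sub>C T v"
  using someI_ex[OF T_scale_uniform] unfolding \<sigma>_def by blast

lemma K_witness: obtains a where "a \<noteq> 0" "K a" "T a \<noteq> 0"
  using dim_ge_3[of e1 e1] T_nonzero by blast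

lemma \<sigma>_one: "\<sigma> 1 = 1"
proof -
  obtain a where a: "K a" "T a \<noteq> 0" using K_witness by blast
  have "1 *\<^sub>C T a = \<sigma> 1 *\<^sub>C T a" using T_scale[OF a(1), of 1] by (simp add: scaleC_one)
  thus ?thesis using a(2) complex_vector.scale_right_imp_eq by metis
qed

lemma \<sigma>_mult: "\<sigma> (c * d) = \<sigma> c * \<sigma> d"
proof -
  obtain a where a: "K a" "T a \<noteq> 0" using K_witness by blast
  have "K (d *\<^sub>C a)" using a by (simp add: cinner_linear)
  hence "\<sigma> (c * d) *\<^sub>C T a = (\<sigma> c * \<sigma> d) *\<^sub>C T a"
    using T_scale[of "d *\<^sub>C a" c] T_scale[OF a(1), of d] T_scale[OF a(1), of "c * d"]
    by (simp add: scaleC_scaleC)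
  thus ?thesis using a(2) complex_vector.scale_right_imp_eq by metis
qed

text \<open>
  For orthogonal \<open>a\<close> and \<open>b\<close> of equal norm, \<open>c (a + b)\<close> and \<open>d (a - b)\<close> are orthogonal as well, and
  their sum has the coefficient \<open>c + d\<close> at \<open>a\<close>.
\<close>

lemma \<sigma>_add: "\<sigma> (c + d) = \<sigma> c + \<sigma> d"
proof -
  obtain a where a: "a \<noteq> 0" "K a" "T a \<noteq> 0" using K_witness by blast
  obtain b' where b': "b' \<noteq> 0" "K b'" "cinner b' a = 0" using dim_ge_3[of e1 a] by blast
  define b where "b = complex_of_real (norm a / norm b') *\<^sub>C b'"
  have b: "K b" "cinner b a = 0" using b' by (simp_all add: b_def cinner_linear)
  hence ab: "cinner a b = 0" using cinner_eq_0_commute by blast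
  have bb: "cinner b b = cinner a a"
    unfolding b_def cinner_rescaled_self[OF b'(1)] by (simp add: cinner_self_norm)
  have Kmb: "K ((- 1) *\<^sub>C b)" using b by (simp add: cinner_linear)
  have "T (c *\<^sub>C (a + b) + d *\<^sub>C (a - b)) = T (c *\<^sub>C (a + b)) + T (d *\<^sub>C (a - b))"
    by (rule T_add_orth) (use a b ab bb in \<open>simp_all add: cinner_linear\<close>)
  moreover have "T (c *\<^sub>C (a + b)) = \<sigma> c *\<^sub>C (T a + T b)"
    using T_scale[of "a + b" c] T_add_orth[OF a(2) b(1) ab] a b by (simp add: cinner_linear)
  moreover have "T (a + (- 1) *\<^sub>C b) = T a + \<sigma> (- 1) *\<^sub>C T b"
    using T_add_orth[OF a(2) Kmb] T_scale[OF b(1), of "- 1"] ab by (simp add: cinner_linear)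
  hence "T (d *\<^sub>C (a - b)) = \<sigma> d *\<^sub>C (T a + \<sigma> (- 1) *\<^sub>C T b)"
    using T_scale[of "a - b" d] a b by (simp add: cinner_linear scaleC_one)
  moreover have "T ((c + d) *\<^sub>C a + (c - d) *\<^sub>C b) = \<sigma> (c + d) *\<^sub>C T a + \<sigma> (c - d) *\<^sub>C T b"
  proof -
    have "T ((c + d) *\<^sub>C a + (c - d) *\<^sub>C b) = T ((c + d) *\<^sub>C a) + T ((c - d) *\<^sub>C b)"
      by (rule T_add_orth) (use a b ab in \<open>simp_all add: cinner_linear\<close>)
    thus ?thesis using T_scale a b by simp
  qed
  moreover have "c *\<^sub>C (a + b) + d *\<^sub>C (a - b) = (c + d) *\<^sub>C a + (c - d) *\<^sub>C b"
    by (simp add: scaleC_add_left scaleC_add_right complex_vector.scale_left_diff_distrib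
        complex_vector.scale_right_diff_distrib)
  ultimately have eq: "\<sigma> (c + d) *\<^sub>C T a + \<sigma> (c - d) *\<^sub>C T b =
      \<sigma> c *\<^sub>C (T a + T b) + \<sigma> d *\<^sub>C (T a + \<sigma> (- 1) *\<^sub>C T b)"
    by simp
  have "cinner (T b) (T a) = 0" using T_orth[OF b(1) a(2)] b(2) by simp
  hence "\<sigma> (c + d) * cinner (T a) (T a) = (\<sigma> c + \<sigma> d) * cinner (T a) (T a)"
    using arg_cong[OF eq, of "\<lambda>z. cinner z (T a)"] by (simp add: cinner_linear distrib_right)
  thus ?thesis using a(3) by simp
qed

lemma \<sigma>_zero: "\<sigma> 0 = 0"
  using \<sigma>_add[of 0 0] by simp

lemma \<sigma>_minus: "\<sigma> (- c) = - \<sigma> c"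
  using \<sigma>_add[of c "- c"] \<sigma>_zero by (simp add: add_eq_0_iff)

lemma T_add:
  assumes v: "K v" and w: "K w"
  shows "T (v + w) = T v + T w"
proof (cases "v = 0")
  case False
  define \<alpha> where "\<alpha> = cinner w v / cinner v v"
  define b where "b = w - \<alpha> *\<^sub>C v"
  have "cinner b v = 0" using False by (simp add: b_def \<alpha>_def cinner_linear)
  hence vb: "cinner v b = 0" using cinner_eq_0_commute by blast
  have b: "K b" using v w by (simp add: b_def cinner_linear)
  have *: "T (c *\<^sub>C v + b) = \<sigma> c *\<^sub>C T v + T b" for c
    using T_add_orth[of "c *\<^sub>C v" b] T_scale[OF v, of c] v b vb by (simp add: cinner_linear)
  have "v + w = (1 + \<alpha>) *\<^sub>C v + b" by (simp add: b_def scaleC_add_left scaleC_one)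
  hence "T (v + w) = (1 + \<sigma> \<alpha>) *\<^sub>C T v + T b" by (simp only: * \<sigma>_add \<sigma>_one)
  moreover have "T w = \<sigma> \<alpha> *\<^sub>C T v + T b" using *[of \<alpha>] by (simp add: b_def)
  ultimately show ?thesis by (simp add: scaleC_add_left scaleC_one)
qed (simp add: T_zero)

text \<open>A nonzero inner product is reduced to the value \<open>- 1\<close> by scaling \<open>w\<close>.\<close>

lemma T_cinner:
  assumes v: "K v" and w: "K w"
  shows "cinner (T v) (T w) = cnj (\<sigma> (cnj (cinner v w)))"
proof (cases "cinner v w = 0")
  case True
  thus ?thesis using T_orth[OF v w] \<sigma>_zero by simp
next
  case False
  define u where "u = cinner v w"
  define k where "k = - 1 / cnj u"
  define y where "y = k *\<^sub>C w"
  have "cinner v y = - 1" using False by (simp add: y_def k_def u_def cinner_linear)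
  moreover have "K y" using w by (simp add: y_def cinner_linear)
  ultimately have "cinner (T v) (T y) = - 1" using T_cinner_minus_1[OF v] by blast
  hence 1: "cnj (\<sigma> k) * cinner (T v) (T w) = - 1"
    using T_scale[OF w, of k] by (simp add: y_def cinner_linear)
  have "k * cnj u = - 1" using False by (simp add: u_def k_def)
  hence "\<sigma> k * \<sigma> (cnj u) = - 1"
    using \<sigma>_mult[of k "cnj u"] \<sigma>_minus[of 1] \<sigma>_one by simp
  hence 2: "cnj (\<sigma> k) * cnj (\<sigma> (cnj u)) = - 1"
    by (metis complex_cnj_minus complex_cnj_mult complex_cnj_one)
  from 1 have "cnj (\<sigma> k) \<noteq> 0" by auto
  with 1 2 have "cinner (T v) (T w) = cnj (\<sigma> (cnj u))" by (metis mult_left_cancel)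
  thus ?thesis by (simp add: u_def)
qed

text \<open>Every \<open>r \<ge> 0\<close> is a squared norm, so \<open>T_cinner\<close> with \<open>v = w\<close> gives the nonnegativity of \<open>\<sigma> r\<close>.\<close>

lemma \<sigma>_id_or_cnj: "\<sigma> = (\<lambda>z. z) \<or> \<sigma> = cnj"
proof (rule complex_endomorphism_id_or_cnj[OF \<sigma>_add \<sigma>_mult \<sigma>_one])
  fix r :: real assume r: "0 \<le> r"
  obtain a where a: "a \<noteq> 0" "K a" using K_witness by blast
  define v where "v = complex_of_real (sqrt r / norm a) *\<^sub>C a"
  have v: "K v" using a by (simp add: v_def cinner_linear)
  have "cinner v v = complex_of_real r"
    unfolding v_def cinner_rescaled_self[OF a(1)] using r by simp
  hence "cnj (\<sigma> (complex_of_real r)) = complex_of_real ((norm (T v))\<^sup>2)"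
    using T_cinner[OF v v] by (simp add: cinner_self_norm)
  hence "\<sigma> (complex_of_real r) = complex_of_real ((norm (T v))\<^sup>2)"
    by (metis complex_cnj_cnj complex_cnj_complex_of_real)
  thus "\<exists>s\<ge>0. \<sigma> (complex_of_real r) = complex_of_real s" by (intro exI[of _ "(norm (T v))\<^sup>2"]) simp
qed

lemma \<sigma>_cnj: "\<sigma> (cnj z) = cnj (\<sigma> z)"
  using \<sigma>_id_or_cnj by auto

text \<open>The \<open>\<sigma>\<close>-linear map with \<open>U (e1 + v) = f1 + T v\<close>.\<close>

definition U :: "'h \<Rightarrow> 'h" where
  "U x = \<sigma> (cinner x e1) *\<^sub>C f1 + T (x - cinner x e1 *\<^sub>C e1)"

lemma K_proj: "K (x - cinner x e1 *\<^sub>C e1)"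
  by (simp add: cinner_linear e1_unit)

lemma U_add: "U (x + y) = U x + U y"
proof -
  have "x + y - cinner (x + y) e1 *\<^sub>C e1 = (x - cinner x e1 *\<^sub>C e1) + (y - cinner y e1 *\<^sub>C e1)"
    by (simp add: cinner_linear scaleC_add_left)
  hence "T (x + y - cinner (x + y) e1 *\<^sub>C e1) =
      T (x - cinner x e1 *\<^sub>C e1) + T (y - cinner y e1 *\<^sub>C e1)"
    by (simp only: T_add[OF K_proj K_proj])
  thus ?thesis
    unfolding U_def by (simp add: cinner_add_left \<sigma>_add scaleC_add_left)
qed

lemma U_scale: "U (c *\<^sub>C x) = \<sigma> c *\<^sub>C U x"
proof -
  have "c *\<^sub>C x - cinner (c *\<^sub>C x) e1 *\<^sub>C e1 = c *\<^sub>C (x - cinner x e1 *\<^sub>C e1)"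
    by (simp add: cinner_linear complex_vector.scale_right_diff_distrib scaleC_scaleC)
  thus ?thesis
    by (simp add: U_def T_scale[OF K_proj] cinner_scaleC_left \<sigma>_mult scaleC_add_right scaleC_scaleC)
qed

lemma U_cinner: "cinner (U x) (U y) = \<sigma> (cinner x y)"
proof -
  define x' where "x' = x - cinner x e1 *\<^sub>C e1"
  define y' where "y' = y - cinner y e1 *\<^sub>C e1"
  have K: "K x'" "K y'" by (simp_all only: x'_def y'_def K_proj)
  have T: "cinner (T x') (T y') = \<sigma> (cinner x' y')"
    using T_cinner[OF K] \<sigma>_cnj by simp
  have "cinner x y = cinner x e1 * cnj (cinner y e1) + cinner x' y'"
    using cinner_commute[of e1 y] by (simp add: x'_def y'_def cinner_linear e1_unit)
  hence "\<sigma> (cinner x y) = \<sigma> (cinner x e1) * cnj (\<sigma> (cinner y e1)) + \<sigma> (cinner x' y')"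
    by (simp add: \<sigma>_add \<sigma>_mult \<sigma>_cnj)
  moreover have "cinner (U x) (U y) =
      \<sigma> (cinner x e1) * cnj (\<sigma> (cinner y e1)) + cinner (T x') (T y')"
    using T_perp_f1[OF K(1)] T_perp_f1[OF K(2)]
    by (simp add: U_def cinner_linear f1_unit flip: x'_def y'_def)
  ultimately show ?thesis using T by simp
qed

lemma U_parallel:
  assumes x: "x \<noteq> 0"
  shows "\<exists>k. k \<noteq> 0 \<and> U x = k *\<^sub>C p x"
proof (cases "cinner x e1 = 0")
  case True
  hence "U x = T x" by (simp add: U_def \<sigma>_zero)
  thus ?thesis using T_parallel[OF True x] by simp
next
  case False
  define a where "a = cinner x e1"
  define v where "v = (1 / a) *\<^sub>C (x - a *\<^sub>C e1)"
  have a: "a \<noteq> 0" using False by (simp add: a_def)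
  have v: "K v" using K_proj[of x] by (simp add: v_def cinner_scaleC_left flip: a_def)
  have xv: "x = a *\<^sub>C (e1 + v)"
    using a by (simp add: v_def scaleC_add_right scaleC_scaleC scaleC_one)
  have "U (e1 + v) = f1 + T v"
    using v by (simp add: U_def cinner_linear e1_unit \<sigma>_one scaleC_one)
  hence U: "U x = \<sigma> a *\<^sub>C (f1 + T v)" using U_scale[of a "e1 + v"] xv by simp
  have "\<sigma> a \<noteq> 0" using a \<sigma>_id_or_cnj by auto
  moreover obtain c where c: "c \<noteq> 0" "f1 + T v = c *\<^sub>C p (e1 + v)" using f1_T_parallel[OF v] by blast
  moreover obtain k where k: "k \<noteq> 0" "p x = k *\<^sub>C p (e1 + v)"
    using p_scale[OF chart_nonzero[OF v] a] xv by metis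
  ultimately have "\<sigma> a * c / k \<noteq> 0" "U x = (\<sigma> a * c / k) *\<^sub>C p x"
    using U by (simp_all add: scaleC_scaleC)
  thus ?thesis by blast
qed

lemma U_surj: "surj U"
  unfolding surj_def
proof
  fix y
  show "\<exists>x. y = U x"
  proof (cases "y = 0")
    case True
    thus ?thesis using U_scale[of 0 0] \<sigma>_zero by (intro exI[of _ 0]) simp
  next
    case False
    then obtain x c where x: "x \<noteq> 0" "y = c *\<^sub>C p x" using p_onto by blast
    obtain k where k: "k \<noteq> 0" "U x = k *\<^sub>C p x" using U_parallel[OF x(1)] by blast
    have "y = (c / k) *\<^sub>C U x" using x k by (simp add: scaleC_scaleC)
    moreover obtain d where "\<sigma> d = c / k" using \<sigma>_id_or_cnj by (metis complex_cnj_cnj)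
    ultimately show ?thesis using U_scale[of d x] by metis
  qed
qed

lemma U_linear_or_antilinear:
  "(\<forall>c x. U (c *\<^sub>C x) = c *\<^sub>C U x) \<and> (\<forall>x y. cinner (U x) (U y) = cinner x y) \<or>
   (\<forall>c x. U (c *\<^sub>C x) = cnj c *\<^sub>C U x) \<and> (\<forall>x y. cinner (U x) (U y) = cnj (cinner x y))"
proof (cases "\<sigma> = cnj")
  case False
  hence "\<sigma> c = c" for c using \<sigma>_id_or_cnj by auto
  thus ?thesis using U_scale U_cinner by simp
next
  case True
  hence "\<sigma> c = cnj c" for c by simp
  thus ?thesis using U_scale U_cinner by simp
qed

end

text \<open>
  Uhlhorn's form of Wigner's theorem: only the vanishing of inner products is assumed to be
  preserved, not the angles between lines.
\<close>

theorem (in line_orth_map) uhlhorn: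
  "\<exists>U. (\<forall>x y. U (x + y) = U x + U y) \<and> surj U \<and> (\<forall>x. x \<noteq> 0 \<longrightarrow> (\<exists>k. k \<noteq> 0 \<and> U x = k *\<^sub>C p x)) \<and>
    ((\<forall>c x. U (c *\<^sub>C x) = c *\<^sub>C U x) \<and> (\<forall>x y. cinner (U x) (U y) = cinner x y) \<or>
     (\<forall>c x. U (c *\<^sub>C x) = cnj c *\<^sub>C U x) \<and> (\<forall>x y. cinner (U x) (U y) = cnj (cinner x y)))"
proof -
  obtain w :: 'h where w: "w \<noteq> 0" using dim_ge_3[of 0 0] by blast
  define e1 where "e1 = complex_of_real (1 / norm w) *\<^sub>C w"
  have "cinner e1 e1 = complex_of_real (1\<^sup>2)"
    unfolding e1_def by (rule cinner_rescaled_self[OF w])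
  hence "cinner e1 e1 = 1" by simp
  hence chart: "line_orth_map_chart p e1"
    by (intro line_orth_map_chart.intro line_orth_map_axioms line_orth_map_chart_axioms.intro)
  show ?thesis
  proof (intro exI[of _ "line_orth_map_chart.U p e1"] conjI allI impI)
    show "surj (line_orth_map_chart.U p e1)" by (rule line_orth_map_chart.U_surj[OF chart])
  qed (rule line_orth_map_chart.U_add[OF chart] line_orth_map_chart.U_parallel[OF chart]
      line_orth_map_chart.U_linear_or_antilinear[OF chart]; assumption?)+
qed

section \<open>Fourier expansion and conjugation\<close>

definition fourier_coeff :: "('i \<Rightarrow> 'a::chilbert_space) \<Rightarrow> 'a \<Rightarrow> 'i \<Rightarrow> complex" where
  "fourier_coeff e x i = cinner x (e i) / cinner (e i) (e i)"

locale hilbert_basis =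
  fixes \<Gamma> :: "'i set" and e :: "'i \<Rightarrow> 'a::chilbert_space"
  assumes basis: "orthogonal_basis \<Gamma> e"
begin

lemma e_nonzero: "i \<in> \<Gamma> \<Longrightarrow> e i \<noteq> 0"
  and e_orth: "i \<in> \<Gamma> \<Longrightarrow> j \<in> \<Gamma> \<Longrightarrow> i \<noteq> j \<Longrightarrow> cinner (e i) (e j) = 0"
  and span_dense: "closure (complex_vector.span (e ` \<Gamma>)) = UNIV"
  using basis by (auto simp: orthogonal_basis_def)

lemma cinner_sum_e:
  assumes "finite F" "F \<subseteq> \<Gamma>" "j \<in> \<Gamma>"
  shows "cinner (\<Sum>i\<in>F. c i *\<^sub>C e i) (e j) = (if j \<in> F then c j * cinner (e j) (e j) else 0)"
proof -
  have "cinner (\<Sum>i\<in>F. c i *\<^sub>C e i) (e j) = (\<Sum>i\<in>F. if i = j then c j * cinner (e j) (e j) else 0)"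
    unfolding cinner_sum_left
    by (intro sum.cong refl) (use assms e_orth in \<open>auto simp: cinner_scaleC_left\<close>)
  thus ?thesis using assms(1) by simp
qed

lemma norm_sum_e:
  assumes "finite F" "F \<subseteq> \<Gamma>"
  shows "(norm (\<Sum>i\<in>F. c i *\<^sub>C e i))\<^sup>2 = (\<Sum>i\<in>F. (cmod (c i) * norm (e i))\<^sup>2)"
  using assms
proof (induction F rule: finite_induct)
  case (insert j F)
  have "cinner (\<Sum>i\<in>F. c i *\<^sub>C e i) (c j *\<^sub>C e j) = 0"
    using insert by (simp add: cinner_scaleC_right cinner_sum_e)
  hence "cinner (c j *\<^sub>C e j) (\<Sum>i\<in>F. c i *\<^sub>C e i) = 0" using cinner_eq_0_commute by blast
  from norm_add_orth[OF this] show ?case using insert by (simp add: norm_scaleC)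
qed simp

text \<open>
  The error of the Fourier sum is orthogonal to the span of the \<open>e i\<close> with \<open>i \<in> F\<close>, so passing to another
  element of that span only adds to its norm.
\<close>

lemma fourier_sum_best:
  assumes F: "finite F" "F \<subseteq> \<Gamma>" and y: "y \<in> complex_vector.span (e ` F)"
  shows "norm (x - (\<Sum>i\<in>F. fourier_coeff e x i *\<^sub>C e i)) \<le> norm (x - y)"
proof -
  define P where "P = (\<Sum>i\<in>F. fourier_coeff e x i *\<^sub>C e i)"
  have "cinner (x - P) (e j) = 0" if "j \<in> F" for j
    using that F e_nonzero[of j]
    by (simp add: P_def cinner_diff_left cinner_sum_e fourier_coeff_def subset_iff)
  moreover have "complex_vector.subspace {z. cinner (x - P) z = 0}"
    by (rule complex_vector.subspaceI) (simp_all add: cinner_add_right cinner_scaleC_right)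
  ultimately have span: "complex_vector.span (e ` F) \<subseteq> {z. cinner (x - P) z = 0}"
    by (intro complex_vector.span_minimal) auto
  have "P \<in> complex_vector.span (e ` F)"
    unfolding P_def
    by (intro complex_vector.span_sum complex_vector.span_scale complex_vector.span_base) auto
  hence "P - y \<in> complex_vector.span (e ` F)" using y by (rule complex_vector.span_diff)
  hence "cinner (x - P) (P - y) = 0" using span by blast
  from norm_add_orth[OF this] have "(norm (x - P))\<^sup>2 \<le> (norm (x - y))\<^sup>2" by simp
  thus ?thesis unfolding P_def by (rule power2_le_imp_le) simp
qed

text \<open>
  Density of the span yields one good approximation that uses finitely many basis vectors, and by
  \<open>fourier_sum_best\<close> the Fourier sums over all larger finite sets are at least as good.
\<close>

lemma fourier_has_sum: "((\<lambda>i. fourier_coeff e x i *\<^sub>C e i) has_sum x) \<Gamma>"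
  unfolding has_sum_def tendsto_iff
proof (intro allI impI)
  fix \<epsilon> :: real assume "0 < \<epsilon>"
  then obtain y where y: "y \<in> complex_vector.span (e ` \<Gamma>)" "dist y x < \<epsilon>"
    using span_dense closure_approachable[of x] by blast
  obtain t r where t: "finite t" "t \<subseteq> e ` \<Gamma>" "y = (\<Sum>a\<in>t. r a *\<^sub>C a)"
    using y(1) unfolding complex_vector.span_explicit by blast
  obtain F where F: "finite F" "F \<subseteq> \<Gamma>" "t = e ` F"
    using finite_subset_image[OF t(1,2)] by blast
  have yF: "y \<in> complex_vector.span (e ` F)"
    unfolding t(3) F(3)
    by (intro complex_vector.span_sum complex_vector.span_scale complex_vector.span_base)
  have "dist (\<Sum>i\<in>G. fourier_coeff e x i *\<^sub>C e i) x < \<epsilon>"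
    if G: "finite G" "F \<subseteq> G" "G \<subseteq> \<Gamma>" for G
  proof -
    have "y \<in> complex_vector.span (e ` G)"
      using yF complex_vector.span_mono[OF image_mono[OF G(2)]] by blast
    from fourier_sum_best[OF G(1,3) this, of x] y(2) show ?thesis
      by (simp add: dist_norm norm_minus_commute)
  qed
  thus "\<forall>\<^sub>F G in finite_subsets_at_top \<Gamma>. dist (\<Sum>i\<in>G. fourier_coeff e x i *\<^sub>C e i) x < \<epsilon>"
    unfolding eventually_finite_subsets_at_top using F by blast
qed

text \<open>
  Conjugating the coefficients preserves the norm of every finite combination of basis vectors,
  so the conjugated series has the same Cauchy property as the original one.
\<close>

lemma cnj_series_summable:
  assumes sum: "(\<lambda>i. c i *\<^sub>C e i) summable_on \<Gamma>"
  shows "(\<lambda>i. cnj (c i) *\<^sub>C e i) summable_on \<Gamma>"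
proof -
  let ?f = "\<lambda>i. c i *\<^sub>C e i" and ?g = "\<lambda>i. cnj (c i) *\<^sub>C e i"
  have dist: "dist (sum ?g F) (sum ?g G) = dist (sum ?f F) (sum ?f G)"
    if F: "finite F" "F \<subseteq> \<Gamma>" and G: "finite G" "G \<subseteq> \<Gamma>" for F G
  proof -
    \<comment> \<open>both differences are combinations over \<open>F \<union> G\<close> whose coefficients agree up to conjugation,
      the factors \<open>d i\<close> being real\<close>
    define d :: "'i \<Rightarrow> complex" where "d i = of_bool (i \<in> F) - of_bool (i \<in> G)" for i
    have diff: "(\<Sum>i\<in>F. b i *\<^sub>C e i) - (\<Sum>i\<in>G. b i *\<^sub>C e i) = (\<Sum>i\<in>F\<union>G. (d i * b i) *\<^sub>C e i)"
      for b :: "'i \<Rightarrow> complex"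
    proof -
      have "(\<Sum>i\<in>F. b i *\<^sub>C e i) = (\<Sum>i\<in>F\<union>G. (of_bool (i \<in> F) * b i) *\<^sub>C e i)"
        by (intro sum.mono_neutral_cong_left) (use F G in auto)
      moreover have "(\<Sum>i\<in>G. b i *\<^sub>C e i) = (\<Sum>i\<in>F\<union>G. (of_bool (i \<in> G) * b i) *\<^sub>C e i)"
        by (intro sum.mono_neutral_cong_left) (use F G in auto)
      ultimately show ?thesis
        by (simp only: d_def left_diff_distrib complex_vector.scale_left_diff_distrib sum_subtractf)
    qed
    have "(norm (sum ?g F - sum ?g G))\<^sup>2 = (norm (sum ?f F - sum ?f G))\<^sup>2"
      unfolding diff using F G by (simp add: norm_sum_e norm_mult)
    thus ?thesis unfolding dist_norm by (rule power2_eq_imp_eq) simp_all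
  qed
  obtain s where "(sum ?f \<longlongrightarrow> s) (finite_subsets_at_top \<Gamma>)"
    using sum unfolding summable_on_def has_sum_def by blast
  hence "cauchy_filter (filtermap (sum ?f) (finite_subsets_at_top \<Gamma>))"
    by (auto intro!: nhds_imp_cauchy_filter simp: filterlim_def)
  hence cauchy_f: "\<exists>P. eventually P (finite_subsets_at_top \<Gamma>) \<and>
      (\<forall>F G. P F \<and> P G \<longrightarrow> dist (sum ?f F) (sum ?f G) < \<epsilon>)" if "0 < \<epsilon>" for \<epsilon>
    using that unfolding cauchy_filter_metric_filtermap by blast
  have fin: "eventually (\<lambda>F. finite F \<and> F \<subseteq> \<Gamma>) (finite_subsets_at_top \<Gamma>)"
    by (simp add: eventually_finite_subsets_at_top_weakI)
  have "cauchy_filter (filtermap (sum ?g) (finite_subsets_at_top \<Gamma>))"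
    unfolding cauchy_filter_metric_filtermap
  proof (intro allI impI)
    fix \<epsilon> :: real assume "0 < \<epsilon>"
    from cauchy_f[OF this] obtain P where P: "eventually P (finite_subsets_at_top \<Gamma>)"
      "\<forall>F G. P F \<and> P G \<longrightarrow> dist (sum ?f F) (sum ?f G) < \<epsilon>"
      by (elim exE conjE)
    have "eventually (\<lambda>F. P F \<and> finite F \<and> F \<subseteq> \<Gamma>) (finite_subsets_at_top \<Gamma>)"
      using P(1) fin by (rule eventually_conj)
    thus "\<exists>P. eventually P (finite_subsets_at_top \<Gamma>) \<and>
        (\<forall>F G. P F \<and> P G \<longrightarrow> dist (sum ?g F) (sum ?g G) < \<epsilon>)"
      using P(2) dist by (intro exI[of _ "\<lambda>F. P F \<and> finite F \<and> F \<subseteq> \<Gamma>"]) auto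
  qed
  moreover have "complete (UNIV :: 'a set)"
    by (meson Cauchy_convergent UNIV_I complete_def convergent_def)
  ultimately obtain L where "(sum ?g \<longlongrightarrow> L) (finite_subsets_at_top \<Gamma>)"
    using complete_uniform[where S = "UNIV :: 'a set"] by (force simp: filterlim_def)
  thus ?thesis unfolding summable_on_def has_sum_def by blast
qed

lemma basis_conj_has_sum:
  "((\<lambda>i. cnj (fourier_coeff e x i) *\<^sub>C e i) has_sum basis_conj \<Gamma> e x) \<Gamma>"
  using has_sum_infsum[OF cnj_series_summable[OF has_sum_imp_summable[OF fourier_has_sum[of x]]]]
  by (simp only: basis_conj_def fourier_coeff_def)

lemma basis_conj_add: "basis_conj \<Gamma> e (x + y) = basis_conj \<Gamma> e x + basis_conj \<Gamma> e y"
proof (rule has_sum_unique[OF basis_conj_has_sum])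
  have eq: "cnj (fourier_coeff e (x + y) i) *\<^sub>C e i =
      cnj (fourier_coeff e x i) *\<^sub>C e i + cnj (fourier_coeff e y i) *\<^sub>C e i" for i
    by (simp add: fourier_coeff_def cinner_add_left add_divide_distrib scaleC_add_left)
  show "((\<lambda>i. cnj (fourier_coeff e (x + y) i) *\<^sub>C e i) has_sum
      basis_conj \<Gamma> e x + basis_conj \<Gamma> e y) \<Gamma>"
    unfolding eq by (rule has_sum_add[OF basis_conj_has_sum basis_conj_has_sum])
qed

lemma basis_conj_scaleC: "basis_conj \<Gamma> e (c *\<^sub>C x) = cnj c *\<^sub>C basis_conj \<Gamma> e x"
proof (rule has_sum_unique[OF basis_conj_has_sum])
  have eq: "cnj (fourier_coeff e (c *\<^sub>C x) i) *\<^sub>C e i =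
      cnj c *\<^sub>C cnj (fourier_coeff e x i) *\<^sub>C e i" for i
    by (simp add: fourier_coeff_def cinner_scaleC_left scaleC_scaleC)
  show "((\<lambda>i. cnj (fourier_coeff e (c *\<^sub>C x) i) *\<^sub>C e i) has_sum cnj c *\<^sub>C basis_conj \<Gamma> e x) \<Gamma>"
    unfolding eq
    using has_sum_bounded_linear[OF bounded_linear_scaleC_right basis_conj_has_sum]
    by (simp add: o_def)
qed

lemma cinner_basis_conj_e:
  assumes "j \<in> \<Gamma>"
  shows "cinner (basis_conj \<Gamma> e x) (e j) = cnj (cinner x (e j))"
proof -
  let ?c = "\<lambda>i. cnj (fourier_coeff e x i)"
  have "((\<lambda>i. cinner (?c i *\<^sub>C e i) (e j)) has_sum cinner (basis_conj \<Gamma> e x) (e j)) \<Gamma>"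
    using has_sum_bounded_linear[OF bounded_linear_cinner_left basis_conj_has_sum]
    by (simp add: o_def)
  moreover have "((\<lambda>i. cinner (?c i *\<^sub>C e i) (e j)) has_sum (?c j * cinner (e j) (e j))) \<Gamma>"
    using assms e_orth
    by (intro has_sum_finite_neutralI[of "{j}"]) (auto simp: cinner_scaleC_left)
  ultimately have "cinner (basis_conj \<Gamma> e x) (e j) = ?c j * cinner (e j) (e j)"
    by (rule has_sum_unique)
  thus ?thesis
    using e_nonzero[OF assms] by (simp add: fourier_coeff_def cinner_self_cnj)
qed

lemma basis_conj_involution: "basis_conj \<Gamma> e (basis_conj \<Gamma> e x) = x"
proof -
  have "((\<lambda>i. cnj (fourier_coeff e (basis_conj \<Gamma> e x) i) *\<^sub>C e i) has_sum x) \<Gamma>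
      \<longleftrightarrow> ((\<lambda>i. fourier_coeff e x i *\<^sub>C e i) has_sum x) \<Gamma>"
    by (intro has_sum_cong) (simp add: fourier_coeff_def cinner_basis_conj_e cinner_self_cnj)
  thus ?thesis using has_sum_unique[OF basis_conj_has_sum] fourier_has_sum by blast
qed

lemma cinner_basis_conj: "cinner (basis_conj \<Gamma> e x) (basis_conj \<Gamma> e y) = cnj (cinner x y)"
proof -
  let ?J = "basis_conj \<Gamma> e" and ?c = "fourier_coeff e x"
  have J: "((\<lambda>i. cinner (cnj (?c i) *\<^sub>C e i) (?J y)) has_sum cinner (?J x) (?J y)) \<Gamma>"
    using has_sum_bounded_linear[OF bounded_linear_cinner_left basis_conj_has_sum]
    by (simp add: o_def)
  have eq: "cinner (cnj (?c i) *\<^sub>C e i) (?J y) = cnj (cinner (?c i *\<^sub>C e i) y)" if "i \<in> \<Gamma>" for i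
  proof -
    have "cinner (e i) (?J y) = cnj (cinner (?J y) (e i))" by (rule cinner_commute)
    thus ?thesis
      using cinner_basis_conj_e[OF that, of y] cinner_commute[of y "e i"]
      by (simp add: cinner_scaleC_left)
  qed
  have "((\<lambda>i. cinner (?c i *\<^sub>C e i) y) has_sum cinner x y) \<Gamma>"
    using has_sum_bounded_linear[OF bounded_linear_cinner_left fourier_has_sum]
    by (simp add: o_def)
  hence "((\<lambda>i. cnj (cinner (?c i *\<^sub>C e i) y)) has_sum cnj (cinner x y)) \<Gamma>"
    using has_sum_bounded_linear[OF bounded_linear_cnj] by (auto simp: o_def)
  moreover have "((\<lambda>i. cinner (cnj (?c i) *\<^sub>C e i) (?J y)) has_sum cnj (cinner x y)) \<Gamma> \<longleftrightarrow>
      ((\<lambda>i. cnj (cinner (?c i *\<^sub>C e i) y)) has_sum cnj (cinner x y)) \<Gamma>"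
    by (rule has_sum_cong) (rule eq)
  ultimately have "((\<lambda>i. cinner (cnj (?c i) *\<^sub>C e i) (?J y)) has_sum cnj (cinner x y)) \<Gamma>"
    by (rule iffD2[rotated])
  with J show ?thesis by (rule has_sum_unique)
qed

end

section \<open>Maps that preserve orthogonality of ranges\<close>

locale range_orth_map =
  fixes \<A> \<B> :: "('h::chilbert_space \<Rightarrow> 'h) set" and \<Phi> :: "('h \<Rightarrow> 'h) \<Rightarrow> ('h \<Rightarrow> 'h)"
  assumes A: "rank_one_ops \<subseteq> \<A>" "\<A> \<subseteq> bounded_ops"
    and B: "rank_one_ops \<subseteq> \<B>" "\<B> \<subseteq> bounded_ops"
    and surj: "\<Phi> ` \<A> = \<B>"
    and orth_iff: "\<And>A B. A \<in> \<A> \<Longrightarrow> B \<in> \<A> \<Longrightarrow> range_orth (\<Phi> A) (\<Phi> B) \<longleftrightarrow> range_orth A B"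
begin

lemma dominated_iff:
  assumes "C \<in> \<A>" "D \<in> \<A>"
  shows "dominated \<B> (\<Phi> C) (\<Phi> D) \<longleftrightarrow> dominated \<A> C D"
  unfolding dominated_def surj[symmetric] using assms orth_iff by simp

lemma rank_one_iff:
  assumes "A \<in> \<A>"
  shows "\<Phi> A \<in> rank_one_ops \<longleftrightarrow> A \<in> rank_one_ops"
proof -
  have "\<Phi> A \<in> \<B>" using assms surj by blast
  have "(\<forall>C\<in>\<B>. \<not> range_orth C C \<and> dominated \<B> C (\<Phi> A) \<longrightarrow> dominated \<B> (\<Phi> A) C) \<longleftrightarrow>
      (\<forall>C\<in>\<A>. \<not> range_orth C C \<and> dominated \<A> C A \<longrightarrow> dominated \<A> A C)"
    unfolding ball_simps(9)[of \<Phi> \<A>, unfolded surj] using assms orth_iff dominated_iff by auto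
  thus ?thesis
    unfolding rank_one_iff_minimal[OF A assms] rank_one_iff_minimal[OF B \<open>\<Phi> A \<in> \<B>\<close>]
    using orth_iff[OF assms assms] by blast
qed

lemma zero_preserved:
  assumes "(\<lambda>_. 0) \<in> \<A>"
  shows "\<Phi> (\<lambda>_. 0) = (\<lambda>_. 0)"
  using orth_iff[OF assms assms] by (simp add: range_orth_self_iff)

text \<open>
  Only the line of \<open>line_map x\<close> matters, which makes the choice of \<open>y\<close> harmless; \<open>\<Phi>_tensor\<close> below shows that
  this line is the range of every \<open>\<Phi> (x \<otimes>\<^sub>o f)\<close>.
\<close>

definition line_map :: "'h \<Rightarrow> 'h" where
  "line_map x = (SOME y. y \<noteq> 0 \<and> (\<exists>g. g \<noteq> 0 \<and> \<Phi> (x \<otimes>\<^sub>o x) = y \<otimes>\<^sub>o g))"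

lemma line_map_self:
  assumes "x \<noteq> 0"
  shows "line_map x \<noteq> 0 \<and> (\<exists>g. g \<noteq> 0 \<and> \<Phi> (x \<otimes>\<^sub>o x) = line_map x \<otimes>\<^sub>o g)"
proof -
  have "x \<otimes>\<^sub>o x \<in> \<A>" "x \<otimes>\<^sub>o x \<in> rank_one_ops" using A rank_one_tensor[OF assms assms] by auto
  hence "\<Phi> (x \<otimes>\<^sub>o x) \<in> rank_one_ops" using rank_one_iff by blast
  hence "\<exists>y. y \<noteq> 0 \<and> (\<exists>g. g \<noteq> 0 \<and> \<Phi> (x \<otimes>\<^sub>o x) = y \<otimes>\<^sub>o g)"
    unfolding rank_one_iff_tensor by blast
  thus ?thesis unfolding line_map_def by (rule someI_ex)
qed

text \<open>The operator \<open>x \<otimes>\<^sub>o f\<close> is dominated by \<open>x \<otimes>\<^sub>o x\<close>, so the same holds for their images.\<close>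

lemma \<Phi>_tensor:
  assumes x: "x \<noteq> 0" and f: "f \<noteq> 0"
  shows "\<exists>g. g \<noteq> 0 \<and> \<Phi> (x \<otimes>\<^sub>o f) = line_map x \<otimes>\<^sub>o g"
proof -
  have r1: "x \<otimes>\<^sub>o f \<in> rank_one_ops" "x \<otimes>\<^sub>o x \<in> rank_one_ops" using x f rank_one_tensor by auto
  hence mem: "x \<otimes>\<^sub>o f \<in> \<A>" "x \<otimes>\<^sub>o x \<in> \<A>" using A by auto
  obtain g where g: "g \<noteq> 0" "\<Phi> (x \<otimes>\<^sub>o x) = line_map x \<otimes>\<^sub>o g" and p: "line_map x \<noteq> 0"
    using line_map_self[OF x] by blast
  have "\<exists>c. (x \<otimes>\<^sub>o f) z = c *\<^sub>C x" for z by (auto simp: tensor_op_def)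
  hence "dominated \<A> (x \<otimes>\<^sub>o f) (x \<otimes>\<^sub>o x)" by (intro dominated_tensorI x)
  hence dom: "dominated \<B> (\<Phi> (x \<otimes>\<^sub>o f)) (line_map x \<otimes>\<^sub>o g)"
    using dominated_iff[OF mem] g(2) by simp
  have \<Phi>1: "\<Phi> (x \<otimes>\<^sub>o f) \<in> rank_one_ops" using rank_one_iff[OF mem(1)] r1(1) by blast
  hence "\<Phi> (x \<otimes>\<^sub>o f) \<in> bounded_ops" by (simp add: rank_one_ops_def)
  from range_in_line_imp_tensor[OF this p dominated_tensor_imp_line[OF B(1) g(1) dom]]
  obtain h where h: "\<Phi> (x \<otimes>\<^sub>o f) = line_map x \<otimes>\<^sub>o h" by blast
  have "h \<noteq> 0"
  proof
    assume "h = 0"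
    hence "\<Phi> (x \<otimes>\<^sub>o f) = line_map x \<otimes>\<^sub>o 0" using h by simp
    also have "\<dots> = (\<lambda>_. 0)" by (simp add: tensor_op_def)
    finally have "range_orth (x \<otimes>\<^sub>o f) (x \<otimes>\<^sub>o f)"
      using orth_iff[OF mem(1) mem(1)] by (simp add: range_orth_self_iff)
    thus False using x f by (simp add: range_orth_tensor_iff)
  qed
  thus ?thesis using h by blast
qed

lemma line_orth_map_line_map:
  assumes "\<exists>S :: 'h set. complex_vector.independent S \<and> card S = 3"
  shows "line_orth_map line_map"
proof
  show "\<exists>w::'h. w \<noteq> 0 \<and> cinner w a = 0 \<and> cinner w b = 0" for a b
    using assms by (rule exists_orth_to_two)
  show "line_map x \<noteq> 0" if "x \<noteq> 0" for x
    using line_map_self[OF that] by blast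
  show "cinner (line_map x) (line_map y) = 0 \<longleftrightarrow> cinner x y = 0" if x: "x \<noteq> 0" and y: "y \<noteq> 0" for x y
  proof -
    obtain g where g: "g \<noteq> 0" "\<Phi> (x \<otimes>\<^sub>o x) = line_map x \<otimes>\<^sub>o g" using line_map_self[OF x] by blast
    obtain h where h: "h \<noteq> 0" "\<Phi> (y \<otimes>\<^sub>o y) = line_map y \<otimes>\<^sub>o h" using line_map_self[OF y] by blast
    have "x \<otimes>\<^sub>o x \<in> \<A>" "y \<otimes>\<^sub>o y \<in> \<A>" using A rank_one_tensor x y by auto
    from orth_iff[OF this] show ?thesis
      by (simp only: g(2) h(2) range_orth_tensor_iff[OF g(1) h(1)] range_orth_tensor_iff[OF x y])
  qed
  show "\<exists>x c. x \<noteq> 0 \<and> y = c *\<^sub>C line_map x" if y: "y \<noteq> 0" for y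
  proof -
    have r1: "y \<otimes>\<^sub>o y \<in> rank_one_ops" using rank_one_tensor y by blast
    hence "y \<otimes>\<^sub>o y \<in> \<Phi> ` \<A>" using B(1) surj by blast
    then obtain C where C: "C \<in> \<A>" "y \<otimes>\<^sub>o y = \<Phi> C" by blast
    hence "C \<in> rank_one_ops" using rank_one_iff[OF C(1)] r1 by simp
    then obtain x f where xf: "x \<noteq> 0" "f \<noteq> 0" "C = x \<otimes>\<^sub>o f" unfolding rank_one_iff_tensor by blast
    obtain g where "\<Phi> C = line_map x \<otimes>\<^sub>o g" using \<Phi>_tensor[OF xf(1,2)] xf(3) by blast
    hence "(y \<otimes>\<^sub>o y) y = (line_map x \<otimes>\<^sub>o g) y" using C(2) by simp
    hence "cinner y y *\<^sub>C y = cinner y g *\<^sub>C line_map x" by (simp add: tensor_op_def)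
    hence "(1 / cinner y y) *\<^sub>C cinner y y *\<^sub>C y = (cinner y g / cinner y y) *\<^sub>C line_map x"
      by (simp add: scaleC_scaleC)
    hence "y = (cinner y g / cinner y y) *\<^sub>C line_map x"
      using y by (simp add: scaleC_scaleC scaleC_one)
    thus ?thesis using xf(1) by blast
  qed
qed

text \<open>The scalar by which \<open>U x\<close> differs from \<open>line_map x\<close> is moved to the other factor of the tensor.\<close>

lemma \<Phi>_tensor_rescaled:
  assumes U: "\<And>x. x \<noteq> 0 \<Longrightarrow> \<exists>k. k \<noteq> 0 \<and> U x = k *\<^sub>C line_map x"
  shows "\<exists>h. \<forall>x f. x \<noteq> 0 \<and> f \<noteq> 0 \<longrightarrow> \<Phi> (x \<otimes>\<^sub>o f) = U x \<otimes>\<^sub>o h (x, f)"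
proof -
  have "\<exists>g. x \<noteq> 0 \<and> f \<noteq> 0 \<longrightarrow> \<Phi> (x \<otimes>\<^sub>o f) = U x \<otimes>\<^sub>o g" for x f
  proof (cases "x = 0 \<or> f = 0")
    case False
    hence x: "x \<noteq> 0" and f: "f \<noteq> 0" by auto
    obtain g where g: "\<Phi> (x \<otimes>\<^sub>o f) = line_map x \<otimes>\<^sub>o g" using \<Phi>_tensor[OF x f] by blast
    obtain k where k: "k \<noteq> 0" "U x = k *\<^sub>C line_map x" using U[OF x] by blast
    have "U x \<otimes>\<^sub>o ((1 / cnj k) *\<^sub>C g) = line_map x \<otimes>\<^sub>o g"
      unfolding k(2) tensor_scale_left using k(1) by (simp add: scaleC_scaleC scaleC_one)
    thus ?thesis using g by metis
  qed auto
  then obtain h where "\<forall>x f. x \<noteq> 0 \<and> f \<noteq> 0 \<longrightarrow> \<Phi> (x \<otimes>\<^sub>o f) = U x \<otimes>\<^sub>o h x f" by metis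
  thus ?thesis by (intro exI[of _ "\<lambda>(x, f). h x f"]) simp
qed

end

theorem theorem2p1:
  fixes \<A> \<B> :: "('h::chilbert_space \<Rightarrow> 'h) set"
    and \<Phi> :: "('h \<Rightarrow> 'h) \<Rightarrow> ('h \<Rightarrow> 'h)"
    and \<Gamma> :: "'i set" and e :: "'i \<Rightarrow> 'h"
  assumes dim: "\<exists>S :: 'h set. complex_vector.independent S \<and> card S = 3"
    and basis: "orthogonal_basis \<Gamma> e"
    and A: "rank_one_ops \<subseteq> \<A>" "\<A> \<subseteq> bounded_ops"
    and B: "rank_one_ops \<subseteq> \<B>" "\<B> \<subseteq> bounded_ops"
    and surj: "\<Phi> ` \<A> = \<B>"
    and orth: "\<forall>A\<in>\<A>. \<forall>B\<in>\<A>.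
      cadjoint A \<circ> B = (\<lambda>_. 0) \<longleftrightarrow> cadjoint (\<Phi> A) \<circ> \<Phi> B = (\<lambda>_. 0)"
  shows "(\<forall>A\<in>\<A>. A \<in> rank_one_ops \<longleftrightarrow> \<Phi> A \<in> rank_one_ops)
    \<and> ((\<lambda>_. 0) \<in> \<A> \<longrightarrow> \<Phi> (\<lambda>_. 0) = (\<lambda>_. 0))
    \<and> (\<exists>(U :: 'h \<Rightarrow> 'h) (h :: 'h \<times> 'h \<Rightarrow> 'h). unitary_op U \<and>
        ((\<forall>x f. x \<noteq> 0 \<and> f \<noteq> 0 \<longrightarrow> \<Phi> (x \<otimes>\<^sub>o f) = U x \<otimes>\<^sub>o h (x, f)) \<or>
         (\<forall>x f. x \<noteq> 0 \<and> f \<noteq> 0 \<longrightarrow> \<Phi> (x \<otimes>\<^sub>o f) = U (basis_conj \<Gamma> e x) \<otimes>\<^sub>o h (x, f))))"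
proof -
  have orth_iff: "range_orth (\<Phi> C) (\<Phi> D) \<longleftrightarrow> range_orth C D" if C: "C \<in> \<A>" and D: "D \<in> \<A>" for C D
  proof -
    have "C \<in> bounded_ops" using C A(2) by blast
    moreover have "\<Phi> C \<in> bounded_ops" using C surj B(2) by blast
    moreover have "cadjoint C \<circ> D = (\<lambda>_. 0) \<longleftrightarrow> cadjoint (\<Phi> C) \<circ> \<Phi> D = (\<lambda>_. 0)"
      using orth C D by blast
    ultimately show ?thesis by (simp only: cadjoint_comp_eq_0_iff range_orth_def)
  qed
  have \<Phi>: "range_orth_map \<A> \<B> \<Phi>"
    by (rule range_orth_map.intro[OF A B surj orth_iff])
  let ?p = "range_orth_map.line_map \<Phi>" and ?J = "basis_conj \<Gamma> e"
  from line_orth_map.uhlhorn[OF range_orth_map.line_orth_map_line_map[OF \<Phi> dim]]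
  obtain U where add: "\<forall>x y. U (x + y) = U x + U y" and Usurj: "surj U"
    and U: "\<forall>x. x \<noteq> 0 \<longrightarrow> (\<exists>k. k \<noteq> 0 \<and> U x = k *\<^sub>C ?p x)"
    and cases: "(\<forall>c x. U (c *\<^sub>C x) = c *\<^sub>C U x) \<and> (\<forall>x y. cinner (U x) (U y) = cinner x y) \<or>
      (\<forall>c x. U (c *\<^sub>C x) = cnj c *\<^sub>C U x) \<and> (\<forall>x y. cinner (U x) (U y) = cnj (cinner x y))"
    by (elim exE conjE)
  obtain h where h: "\<forall>x f. x \<noteq> 0 \<and> f \<noteq> 0 \<longrightarrow> \<Phi> (x \<otimes>\<^sub>o f) = U x \<otimes>\<^sub>o h (x, f)"
    using range_orth_map.\<Phi>_tensor_rescaled[OF \<Phi> U[rule_format]] by blast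
  have "\<exists>(U :: 'h \<Rightarrow> 'h) (h :: 'h \<times> 'h \<Rightarrow> 'h). unitary_op U \<and>
      ((\<forall>x f. x \<noteq> 0 \<and> f \<noteq> 0 \<longrightarrow> \<Phi> (x \<otimes>\<^sub>o f) = U x \<otimes>\<^sub>o h (x, f)) \<or>
       (\<forall>x f. x \<noteq> 0 \<and> f \<noteq> 0 \<longrightarrow> \<Phi> (x \<otimes>\<^sub>o f) = U (?J x) \<otimes>\<^sub>o h (x, f)))"
    using cases
  proof
    assume lin: "(\<forall>c x. U (c *\<^sub>C x) = c *\<^sub>C U x) \<and> (\<forall>x y. cinner (U x) (U y) = cinner x y)"
    have "unitary_op U"
      by (rule unitary_opI) (use add Usurj lin in auto)
    thus ?thesis using h by blast
  next
    assume anti: "(\<forall>c x. U (c *\<^sub>C x) = cnj c *\<^sub>C U x) \<and> (\<forall>x y. cinner (U x) (U y) = cnj (cinner x y))"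
    interpret hilbert_basis \<Gamma> e by (rule hilbert_basis.intro[OF basis])
    have "unitary_op (\<lambda>x. U (?J x))"
    proof (rule unitary_opI)
      show "U (?J (x + y)) = U (?J x) + U (?J y)" for x y by (simp add: basis_conj_add add)
      show "U (?J (c *\<^sub>C x)) = c *\<^sub>C U (?J x)" for c x using anti by (simp add: basis_conj_scaleC)
      show "cinner (U (?J x)) (U (?J y)) = cinner x y" for x y
        using anti by (simp add: cinner_basis_conj)
      show "surj (\<lambda>x. U (?J x))"
        unfolding surj_def using surjD[OF Usurj] basis_conj_involution by metis
    qed
    moreover have "\<forall>x f. x \<noteq> 0 \<and> f \<noteq> 0 \<longrightarrow> \<Phi> (x \<otimes>\<^sub>o f) = U (?J (?J x)) \<otimes>\<^sub>o h (x, f)"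
      using h by (simp only: basis_conj_involution)
    ultimately show ?thesis by blast
  qed
  moreover have "\<forall>A\<in>\<A>. A \<in> rank_one_ops \<longleftrightarrow> \<Phi> A \<in> rank_one_ops"
    using range_orth_map.rank_one_iff[OF \<Phi>] by blast
  moreover have "(\<lambda>_. 0) \<in> \<A> \<longrightarrow> \<Phi> (\<lambda>_. 0) = (\<lambda>_. 0)"
    using range_orth_map.zero_preserved[OF \<Phi>] by blast
  ultimately show ?thesis by (intro conjI)
qed

end
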